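(* Let $T\colon X\to X$ be a transitive expanding covering map on a compact metric space $(X,d)$, and let $A\colon X\to\mathbb{R}$ be $\alpha$-Hölder continuous with $\alpha\in(0,1]$. For $\beta>0$ let $g_\beta:=\beta A+\log u_{\beta A}-\log u_{\beta A}\circ T-P(T,\beta A)$. Then the following statements are true: (i) The two families $\{g_\beta/\beta\}_{\beta\in(1,+\infty)}$ and $\{l_\beta^\mu(\cdot)\}_{\beta\in(1,+\infty)}$ are normal. (ii) Suppose $\{g_{\beta_k}/\beta_k\}_{k\in\mathbb{N}}$ (uniformly) converges to a function $\widehat{A}\in C(X,\mathbb{R})$ and $\{l_{\beta_k}^\mu(\cdot)\}_{k\in\mathbb{N}}$ (pointwise) converges to $\widehat{l}\colon C(X,\mathbb{R})\to\mathbb{R}$ with $\beta_k\to+\infty$ as $k\to+\infty$. Then $\widehat{l}$ is a tropical linear functional. Let $\widehat{b}$ be the density of $\widehat{l}$ in $D_{\max}(X)$. Then $\mathcal{L}_{\widehat{A}}^{\circledast}(\widehat{b})=\widehat{b}$, i.e., $\widehat{b}\circ T+\widehat{A}=\widehat{b}$. (iii) Suppose $\{\frac1{\beta_k}\log u_{\beta_kA}\}_{k\in\mathbb{N}}$ (uniformly) converges to a function $v\in C(X,\mathbb{R})$ with $\beta_k\to+\infty$ as $k\to+\infty$. Then $\{g_{\beta_k}/\beta_k\}_{k\in\mathbb{N}}$ (uniformly) converges to $\overline{A}+v-v\circ T$ as $k\to+\infty$.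
   Context: $T$ is distance-expanding if there exist $\lambda>1$, $\eta>0$ such that $d(x,y)\le2\eta$ implies $d(Tx,Ty)\ge\lambda d(x,y)$. An expanding covering map is an open, continuous, surjective, distance-expanding local homeomorphism $T\colon X\to X$. Transitive means topologically transitive. For $\varphi\in C(X,\mathbb{R})$, $\mathcal{R}_\varphi(u)(x)=\sum_{y\in T^{-1}(x)}u(y)e^{\varphi(y)}$ is the Ruelle operator on $C(X,\mathbb{R})$, with adjoint $\mathcal{R}_\varphi^*$ on measures, and $P(T,\varphi)$ is the topological pressure. For $\beta>0$, $m_{\beta A}$ is the unique Borel probability measure with $\mathcal{R}_{\beta A}^*(m_{\beta A})=e^{P(T,\beta A)}m_{\beta A}$; $u_{\beta A}\in C(X,\mathbb{R})$ is the unique (strictly positive) function with $\mathcal{R}_{\beta A}(u_{\beta A})=e^{P(T,\beta A)}u_{\beta A}$ and $\int u_{\beta A}\,\mathrm{d}m_{\beta A}=1$; $\mu_{\beta A}=u_{\beta A}\cdot m_{\beta A}$ is the unique equilibrium state for $\beta A$. For $f\in C(X,\mathbb{R})$, $l_\beta^\mu(f)=\frac1\beta\log\int e^{\beta f}\,\mathrm{d}\mu_{\beta A}$. $\overline{A}=A-Q(T,A)$, where $Q(T,A)=\sup\{\int A\,\mathrm{d}\mu:\mu\text{ a }T\text{-invariant Borel probability measure}\}$. A family of real-valued continuous functions on $X$ (resp. functionals on $C(X,\mathbb{R})$ with the uniform norm) is normal if every sequence in it has a subsequence converging uniformly on every compact subset of $X$ (resp. of $C(X,\mathbb{R})$). A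 functional $l\colon C(X,\mathbb{R})\to\mathbb{R}$ is tropical linear if $l(\max\{f,g\})=\max\{l(f),l(g)\}$ and $l(c+f)=c+l(f)$ for all $f,g\in C(X,\mathbb{R})$ and constants $c\in\mathbb{R}$ (it is extended to the constant functions $\pm\infty$ by $l(\pm\infty)=\pm\infty$). $D_{\max}(X)=\{b\colon X\to\mathbb{R}\cup\{-\infty\}\text{ upper semi-continuous}\}\cup\{+\infty\}$. The density of $l$ in $D_{\max}(X)$ is the (unique) $b\in D_{\max}(X)$ with $l(f)=\sup_{x\in X}(f(x)+b(x))$ for all $f\in C(X,\mathbb{R})$. For $B\in C(X,\mathbb{R})$, the tropical adjoint Bousch operator is $\mathcal{L}_B^{\circledast}(b)(x)=b(T(x))+B(x)$, $b\in D_{\max}(X)$. *)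

theory Defs
  imports "HOL-Probability.Probability"
begin

(* The compact metric space X is the carrier of the type 'a, with compactness of UNIV assumed in
   the theorem; types are nonempty.  For compact X every continuous function is bounded, so the
   type "'a \<Rightarrow>\<^sub>C real" with its metric is C(X) with the uniform norm. *)

definition distance_expanding :: "('a::metric_space \<Rightarrow> 'a) \<Rightarrow> bool" where
  "distance_expanding T \<longleftrightarrow>
     (\<exists>lam>1. \<exists>eta>0. \<forall>x y. dist x y \<le> 2 * eta \<longrightarrow> dist (T x) (T y) \<ge> lam * dist x y)"

definition local_homeomorphism :: "('a::topological_space \<Rightarrow> 'b::topological_space) \<Rightarrow> bool" where
  "local_homeomorphism T \<longleftrightarrow>
     (\<forall>x. \<exists>U. open U \<and> x \<in> U \<and> open (T ` U) \<and> (\<exists>S. homeomorphism U (T ` U) T S))"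

definition expanding_covering_map :: "('a::metric_space \<Rightarrow> 'a) \<Rightarrow> bool" where
  "expanding_covering_map T \<longleftrightarrow>
     (\<forall>U. open U \<longrightarrow> open (T ` U)) \<and> continuous_on UNIV T \<and> surj T \<and>
     distance_expanding T \<and> local_homeomorphism T"

definition topologically_transitive :: "('a::topological_space \<Rightarrow> 'a) \<Rightarrow> bool" where
  "topologically_transitive T \<longleftrightarrow>
     (\<forall>U V. open U \<and> U \<noteq> {} \<and> open V \<and> V \<noteq> {} \<longrightarrow> (\<exists>n. (T ^^ n) ` U \<inter> V \<noteq> {}))"

definition holder_continuous :: "real \<Rightarrow> ('a::metric_space \<Rightarrow> real) \<Rightarrow> bool" where
  "holder_continuous \<alpha> A \<longleftrightarrow> (\<exists>C. \<forall>x y. \<bar>A x - A y\<bar> \<le> C * dist x y powr \<alpha>)"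

definition birkhoff_sum :: "('a \<Rightarrow> 'a) \<Rightarrow> ('a \<Rightarrow> real) \<Rightarrow> nat \<Rightarrow> 'a \<Rightarrow> real" where
  "birkhoff_sum T \<phi> n x = (\<Sum>k<n. \<phi> ((T ^^ k) x))"

definition dyn_separated :: "('a::metric_space \<Rightarrow> 'a) \<Rightarrow> nat \<Rightarrow> real \<Rightarrow> 'a set \<Rightarrow> bool" where
  "dyn_separated T n \<epsilon> E \<longleftrightarrow>
     (\<forall>x\<in>E. \<forall>y\<in>E. x \<noteq> y \<longrightarrow> (\<exists>k<n. dist ((T ^^ k) x) ((T ^^ k) y) > \<epsilon>))"

(* Topological pressure through (n,\<epsilon>)-separated sets:
     lim (\<epsilon> \<rightarrow> 0) limsup (n \<rightarrow> \<infinity>) (1/n) log sup_E (\<Sum>x\<in>E. exp (S_n \<phi> x)).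
   The limsup is antitone in \<epsilon>, so the limit is a supremum; the increasing functions log and
   division by n are moved inside the supremum over E. *)
definition ereal_pressure :: "('a::metric_space \<Rightarrow> 'a) \<Rightarrow> ('a \<Rightarrow> real) \<Rightarrow> ereal" where
  "ereal_pressure T \<phi> =
     (SUP \<epsilon>\<in>{0<..}. limsup (\<lambda>n.
        SUP E\<in>{E. finite E \<and> E \<noteq> {} \<and> dyn_separated T n \<epsilon> E}.
          ereal (ln (\<Sum>x\<in>E. exp (birkhoff_sum T \<phi> n x)) / real n)))"

(* The pressure of a distance-expanding continuous map on a compact space is finite. *)
definition pressure :: "('a::metric_space \<Rightarrow> 'a) \<Rightarrow> ('a \<Rightarrow> real) \<Rightarrow> real" where
  "pressure T \<phi> = real_of_ereal (ereal_pressure T \<phi>)"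

definition ruelle :: "('a \<Rightarrow> 'a) \<Rightarrow> ('a \<Rightarrow> real) \<Rightarrow> ('a \<Rightarrow> real) \<Rightarrow> 'a \<Rightarrow> real" where
  "ruelle T \<phi> u x = (\<Sum>y\<in>T -` {x}. u y * exp (\<phi> y))"

definition borel_prob :: "'a::topological_space measure \<Rightarrow> bool" where
  "borel_prob \<mu> \<longleftrightarrow> sets \<mu> = sets borel \<and> prob_space \<mu>"

(* R\<^sup>* m = e^P m, as an identity of functionals on C(X). *)
definition eigenmeasure :: "('a::metric_space \<Rightarrow> 'a) \<Rightarrow> ('a \<Rightarrow> real) \<Rightarrow> 'a measure \<Rightarrow> bool" where
  "eigenmeasure T \<phi> m \<longleftrightarrow> borel_prob m \<and>
     (\<forall>f. continuous_on UNIV f \<longrightarrow>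
        (\<integral>x. ruelle T \<phi> f x \<partial>m) = exp (pressure T \<phi>) * (\<integral>x. f x \<partial>m))"

definition eigenfunction ::
  "('a::metric_space \<Rightarrow> 'a) \<Rightarrow> ('a \<Rightarrow> real) \<Rightarrow> 'a measure \<Rightarrow> ('a \<Rightarrow> real) \<Rightarrow> bool" where
  "eigenfunction T \<phi> m u \<longleftrightarrow> continuous_on UNIV u \<and> (\<forall>x. u x > 0) \<and>
     (\<forall>x. ruelle T \<phi> u x = exp (pressure T \<phi>) * u x) \<and> (\<integral>x. u x \<partial>m) = 1"

definition equilibrium_state :: "'a measure \<Rightarrow> ('a \<Rightarrow> real) \<Rightarrow> 'a measure" where
  "equilibrium_state m u = density m (\<lambda>x. ennreal (u x))"

definition normalized_potential ::
  "('a::metric_space \<Rightarrow> 'a) \<Rightarrow> ('a \<Rightarrow> real) \<Rightarrow> ('a \<Rightarrow> real) \<Rightarrow> 'a \<Rightarrow> real" where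
  "normalized_potential T \<phi> u x = \<phi> x + ln (u x) - ln (u (T x)) - pressure T \<phi>"

definition log_laplace ::
  "real \<Rightarrow> 'a::topological_space measure \<Rightarrow> ('a \<Rightarrow>\<^sub>C real) \<Rightarrow> real" where
  "log_laplace \<beta> \<mu> f = ln (\<integral>x. exp (\<beta> * f x) \<partial>\<mu>) / \<beta>"

definition max_ergodic_average :: "('a::topological_space \<Rightarrow> 'a) \<Rightarrow> ('a \<Rightarrow> real) \<Rightarrow> real" where
  "max_ergodic_average T A =
     (SUP \<mu>\<in>{\<mu>. borel_prob \<mu> \<and> distr \<mu> borel T = \<mu>}. \<integral>x. A x \<partial>\<mu>)"

(* Used both for functions on X and for functionals on C(X). *)
definition normal_family :: "('b::topological_space \<Rightarrow> real) set \<Rightarrow> bool" where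
  "normal_family F \<longleftrightarrow>
     (\<forall>f::nat \<Rightarrow> 'b \<Rightarrow> real. range f \<subseteq> F \<longrightarrow>
        (\<exists>r h. strict_mono r \<and> (\<forall>K. compact K \<longrightarrow> uniform_limit K (f \<circ> r) h sequentially)))"

definition bcont_max ::
  "('a::topological_space \<Rightarrow>\<^sub>C real) \<Rightarrow> ('a \<Rightarrow>\<^sub>C real) \<Rightarrow> ('a \<Rightarrow>\<^sub>C real)" where
  "bcont_max f g = Bcontfun (\<lambda>x. max (f x) (g x))"

lemma apply_bcont_max [simp]: "apply_bcontfun (bcont_max f g) x = max (f x) (g x)"
proof -
  have "continuous_on UNIV (\<lambda>x. max (f x) (g x))"
    by (intro continuous_on_max) auto
  moreover have "bounded (range (\<lambda>x. max (f x) (g x)))"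
    unfolding bounded_iff
  proof (intro exI ballI)
    fix y assume "y \<in> range (\<lambda>x. max (f x) (g x))"
    then obtain x where "y = max (f x) (g x)" by auto
    then show "norm y \<le> max (norm f) (norm g)"
      using norm_bounded[of f x] norm_bounded[of g x] by (auto simp: max_def)
  qed
  ultimately show ?thesis
    by (simp add: bcont_max_def bcontfun_def Bcontfun_inverse)
qed

definition tropical_linear :: "(('a::topological_space \<Rightarrow>\<^sub>C real) \<Rightarrow> real) \<Rightarrow> bool" where
  "tropical_linear l \<longleftrightarrow>
     (\<forall>f g. l (bcont_max f g) = max (l f) (l g)) \<and>
     (\<forall>c f. l (const_bcontfun c + f) = c + l f)"

definition upper_semicontinuous :: "('a::topological_space \<Rightarrow> ereal) \<Rightarrow> bool" where
  "upper_semicontinuous b \<longleftrightarrow> (\<forall>c. open {x. b x < c})"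

definition D_max :: "('a::topological_space \<Rightarrow> ereal) set" where
  "D_max = {b. (\<forall>x. b x \<noteq> \<infinity>) \<and> upper_semicontinuous b} \<union> {\<lambda>x. \<infinity>}"

definition tropical_density ::
  "(('a::topological_space \<Rightarrow>\<^sub>C real) \<Rightarrow> real) \<Rightarrow> ('a \<Rightarrow> ereal) \<Rightarrow> bool" where
  "tropical_density l b \<longleftrightarrow>
     b \<in> D_max \<and> (\<forall>f. ereal (l f) = (SUP x. ereal (apply_bcontfun f x) + b x))"

definition bousch_adjoint ::
  "('a \<Rightarrow> 'a) \<Rightarrow> ('a \<Rightarrow> real) \<Rightarrow> ('a \<Rightarrow> ereal) \<Rightarrow> 'a \<Rightarrow> ereal" where
  "bousch_adjoint T B b x = b (T x) + ereal (B x)"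

end

theory Submission
  imports Defs "HOL-Complex_Analysis.Great_Picard"
begin

text \<open>
  Fix \<open>\<beta>\<close>, let \<open>R\<close> be the Ruelle operator and \<open>P\<close> the pressure of \<open>\<beta> * A\<close>, and write \<open>m\<close>, \<open>u\<close>, \<open>g\<close>
  for the data at \<open>\<beta>\<close>. The pressure enters only as the exponent of the eigenvalue in
  \<open>R u = exp P * u\<close> and \<open>R\<^sup>* m = exp P * m\<close>. The first equation says that the weights \<open>exp g\<close> sum to 1
  over every fibre of \<open>T\<close>. Together with the second it says that \<open>\<mu> = u * m\<close> is fixed by the dual of
  averaging over fibres with these weights; hence \<open>\<mu>\<close> is \<open>T\<close>-invariant.

  Zero temperature limit of the pressure. The weights are at most 1, so \<open>g \<le> 0\<close>, and integrating over
  a \<open>T\<close>-invariant measure kills the coboundary in \<open>g\<close> and leaves \<open>\<beta> * \<integral>A \<le> P\<close>. Conversely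
  \<open>- t * exp t \<le> 1\<close> bounds the weighted fibre sums of \<open>- g\<close> by any bound \<open>N\<close> of the fibre sizes, and
  integrating over \<open>\<mu>\<close> gives \<open>P \<le> \<beta> * \<integral>A + N\<close>. So \<open>P / \<beta>\<close> differs from the maximal ergodic average
  by at most \<open>N / \<beta>\<close>. The third claim follows, because \<open>g / \<beta>\<close> is \<open>A - P / \<beta>\<close> plus the coboundary
  of \<open>ln u / \<beta>\<close>.

  Normality of the potentials. Fibres over nearby points can be paired so that distances shrink by the
  factor \<open>1 / lam\<close>. Comparing \<open>R u\<close> at the two points and iterating bounds the oscillation of \<open>ln u\<close> by
  the Hoelder modulus of \<open>\<beta> * A\<close> summed over a geometric series (\<open>ln_u_local\<close>); after division by \<open>\<beta>\<close>
  the bound does not depend on \<open>\<beta>\<close>. By transitivity, preimages under a uniformly bounded number of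
  steps are dense at the scale where that bound applies, which gives a global oscillation bound
  (\<open>ln_u_oscillation\<close>). The Arzela-Ascoli argument (\<open>normal_family_if_equicontinuous\<close>) concludes.
  The same argument on the metric space of continuous functions handles the log-Laplace functionals:
  they are 1-Lipschitz, and that space is separable.

  The limit functional. Up to \<open>ln 2 / \<beta>\<close> the log-Laplace functional commutes with maxima, so limits
  are tropical linear, and a tropical linear functional has exactly one density, the infimum of
  \<open>l f - f x\<close> over all \<open>f\<close>. Duality writes the \<open>\<mu>\<close>-integral of \<open>exp (\<beta> * f)\<close> as that of the fibre sums
  of \<open>exp (\<beta> * (f + g / \<beta>))\<close>, and a sum of at most \<open>N\<close> exponentials is a maximum up to \<open>ln N / \<beta>\<close>
  (\<open>log_laplace_transfer\<close>). In the limit \<open>l f = l F\<close>, where \<open>F x\<close> is the maximum of \<open>f + B\<close> over the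
  fibre of \<open>x\<close> and \<open>B\<close> is the limit of \<open>g / \<beta>\<close>. If \<open>b\<close> is the density of \<open>l\<close>, this says that
  \<open>b \<circ> T + B\<close> is a density too, and uniqueness gives \<open>b \<circ> T + B = b\<close>.
\<close>


section \<open>Equicontinuous families and separability\<close>

text \<open>Arzela-Ascoli without compactness of the domain. A diagonal subsequence converges on the
  dense set; equicontinuity makes it Cauchy at every point, and a finite subcover makes the
  convergence uniform on each compact set.\<close>
lemma normal_family_if_equicontinuous:
  fixes F :: "('b::metric_space \<Rightarrow> real) set" and D :: "'b set"
  assumes D: "countable D" "closure D = UNIV"
    and bounded: "\<And>x. \<exists>M. \<forall>f\<in>F. \<bar>f x\<bar> \<le> M"
    and equicont: "\<And>x e. e > 0 \<Longrightarrow> \<exists>d>0. \<forall>f\<in>F. \<forall>y. dist x y < d \<longrightarrow> \<bar>f x - f y\<bar> < e"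
  shows "normal_family F"
  unfolding normal_family_def
proof (intro allI impI)
  fix f :: "nat \<Rightarrow> 'b \<Rightarrow> real"
  assume "range f \<subseteq> F"
  then have f: "f n \<in> F" for n by auto
  obtain M :: "'b \<Rightarrow> real" where M: "\<And>x f. f \<in> F \<Longrightarrow> \<bar>f x\<bar> \<le> M x"
    using bounded by metis
  define s where "s x = 1 / (\<bar>M x\<bar> + 1)" for x
  have s: "s x > 0" for x by (simp add: s_def add_nonneg_pos)
  \<comment> \<open>The weight \<open>s\<close> turns the pointwise bound into a uniform one, as
    the diagonal argument requires.\<close>
  have scaled: "norm (s x * f n x) \<le> 1" for n x
    using M[OF f[of n], of x] by (simp add: s_def field_simps abs_mult)
  obtain r where r: "strict_mono (r :: nat \<Rightarrow> nat)"
    and rD: "\<And>x. x \<in> D \<Longrightarrow> \<exists>l. (\<lambda>n. s x * f (r n) x) \<longlonglongrightarrow> l"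
    by (rule function_convergent_subsequence[OF D(1), of "\<lambda>n x. s x * f n x" 1])
      (use scaled in blast)+
  have convD: "convergent (\<lambda>n. f (r n) x)" if x: "x \<in> D" for x
  proof -
    obtain l where "(\<lambda>n. s x * f (r n) x) \<longlonglongrightarrow> l" using rD[OF x] by blast
    then have "(\<lambda>n. (s x * f (r n) x) / s x) \<longlonglongrightarrow> l / s x"
      using s[of x] by (intro tendsto_intros) auto
    then show ?thesis using s[of x] by (auto simp: convergent_def)
  qed
  have "convergent (\<lambda>n. f (r n) x)" for x
  proof (rule Cauchy_convergent, rule CauchyI)
    fix e :: real assume "e > 0"
    then obtain d where d: "d > 0" "\<And>f y. f \<in> F \<Longrightarrow> dist x y < d \<Longrightarrow> \<bar>f x - f y\<bar> < e / 3"
      using equicont[of "e / 3" x] by auto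
    obtain y where y: "y \<in> D" "dist x y < d"
      using D(2) d(1) by (metis UNIV_I closure_approachable dist_commute)
    obtain N where N: "\<And>i j. i \<ge> N \<Longrightarrow> j \<ge> N \<Longrightarrow> norm (f (r i) y - f (r j) y) < e / 3"
      using convergent_Cauchy[OF convD[OF y(1)]] \<open>e > 0\<close> CauchyD[of "\<lambda>n. f (r n) y" "e / 3"]
      by auto
    show "\<exists>N. \<forall>i\<ge>N. \<forall>j\<ge>N. norm (f (r i) x - f (r j) x) < e"
    proof (intro exI allI impI)
      fix i j assume "i \<ge> N" "j \<ge> N"
      then show "norm (f (r i) x - f (r j) x) < e"
        using N[of i j] d(2)[OF f[of "r i"] y(2)] d(2)[OF f[of "r j"] y(2)]
        unfolding real_norm_def by linarith
    qed
  qed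
  then obtain h where h: "\<And>x. (\<lambda>n. f (r n) x) \<longlonglongrightarrow> h x"
    unfolding convergent_def by metis
  have "uniform_limit K (f \<circ> r) h sequentially" if "compact K" for K
  proof (rule uniform_limitI)
    fix e :: real assume "e > 0"
    have "\<exists>d>0. \<forall>f\<in>F. \<forall>y. dist x y < d \<longrightarrow> \<bar>f x - f y\<bar> < e / 4" for x
      using equicont[of "e / 4" x] \<open>e > 0\<close> by auto
    then obtain d where d: "\<And>x. d x > 0"
      "\<And>x f y. f \<in> F \<Longrightarrow> dist x y < d x \<Longrightarrow> \<bar>f x - f y\<bar> < e / 4"
      by metis
    have hd: "\<bar>h x - h y\<bar> \<le> e / 4" if xy: "dist x y < d x" for x y
    proof (rule tendsto_le[OF _ tendsto_const])
      show "(\<lambda>n. \<bar>f (r n) x - f (r n) y\<bar>) \<longlonglongrightarrow> \<bar>h x - h y\<bar>"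
        by (intro tendsto_intros h)
      show "\<forall>\<^sub>F n in sequentially. \<bar>f (r n) x - f (r n) y\<bar> \<le> e / 4"
        using d(2)[OF f xy] by (intro always_eventually) (auto intro: less_imp_le)
    qed simp
    obtain C where C: "C \<subseteq> K" "finite C" "K \<subseteq> (\<Union>x\<in>C. ball x (d x))"
      using compactE_image[OF \<open>compact K\<close>, of K "\<lambda>x. ball x (d x)"] d(1) by force
    have "\<forall>\<^sub>F n in sequentially. \<forall>x\<in>C. dist (f (r n) x) (h x) < e / 4"
      using C(2) \<open>e > 0\<close> by (intro eventually_ball_finite ballI tendstoD[OF h]) auto
    then show "\<forall>\<^sub>F n in sequentially. \<forall>y\<in>K. dist ((f \<circ> r) n y) (h y) < e"
    proof (rule eventually_mono, intro ballI)
      fix n y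
      assume n: "\<forall>x\<in>C. dist (f (r n) x) (h x) < e / 4" and "y \<in> K"
      then obtain x where x: "x \<in> C" "dist x y < d x" using C(3) by auto
      show "dist ((f \<circ> r) n y) (h y) < e"
        using n[rule_format, OF x(1)] hd[OF x(2)] d(2)[OF f[of "r n"] x(2)] \<open>e > 0\<close>
        unfolding comp_def dist_real_def by linarith
    qed
  qed
  with r show "\<exists>r h. strict_mono r \<and> (\<forall>K. compact K \<longrightarrow> uniform_limit K (f \<circ> r) h sequentially)"
    by blast
qed

lemma compact_UNIV_finite_subcover:
  fixes U :: "'a::topological_space \<Rightarrow> 'a set"
  assumes "compact (UNIV :: 'a set)" "\<And>x. open (U x)" "\<And>x. x \<in> U x"
  obtains I where "finite I" "\<And>y. \<exists>x\<in>I. y \<in> U x"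
proof -
  have "UNIV \<subseteq> (\<Union>x\<in>UNIV. U x)" using assms(3) by blast
  then obtain I where "finite I" "UNIV \<subseteq> (\<Union>x\<in>I. U x)"
    by (rule compactE_image[OF assms(1), rotated]) (use assms(2) in auto)
  then show ?thesis by (intro that[of I]) blast+
qed

lemma finite_net:
  assumes "compact (UNIV :: 'a::metric_space set)" "e > 0"
  shows "\<exists>N :: 'a set. finite N \<and> (\<forall>x. \<exists>y\<in>N. dist x y < e)"
proof -
  have "open (ball x e)" "x \<in> ball x e" for x :: 'a using assms(2) by auto
  then obtain N :: "'a set" where "finite N" "\<And>x. \<exists>y\<in>N. x \<in> ball y e"
    using compact_UNIV_finite_subcover[OF assms(1), of "\<lambda>x. ball x e"] by blast
  then show ?thesis by (intro exI[of _ N]) (simp add: dist_commute)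
qed

lemma compact_UNIV_uniformly_continuous:
  fixes f :: "'a::metric_space \<Rightarrow> real"
  assumes "compact (UNIV :: 'a set)" "continuous_on UNIV f" "e > 0"
  obtains d where "d > 0" "\<And>x y. dist x y < d \<Longrightarrow> \<bar>f x - f y\<bar> < e"
proof -
  have "uniformly_continuous_on UNIV f"
    by (rule compact_uniformly_continuous[OF assms(2,1)])
  then obtain d where "d > 0" "\<And>x y. dist x y < d \<Longrightarrow> dist (f y) (f x) < e"
    unfolding uniformly_continuous_on_def using assms(3) by (metis UNIV_I dist_commute)
  then show ?thesis by (intro that[of d]) (simp_all add: dist_real_def abs_minus_commute)
qed

lemma compact_countable_dense:
  assumes "compact (UNIV :: 'a::metric_space set)"
  shows "\<exists>D :: 'a set. countable D \<and> closure D = UNIV"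
proof -
  have "\<exists>N. finite N \<and> (\<forall>x :: 'a. \<exists>y\<in>N. dist x y < inverse (real (Suc n)))" for n
    by (rule finite_net[OF assms]) auto
  then obtain N where N: "\<And>n. finite (N n)"
    "\<And>n (x :: 'a). \<exists>y\<in>N n. dist x y < inverse (real (Suc n))"
    by metis
  show ?thesis
  proof (intro exI[of _ "\<Union>n. N n"] conjI)
    show "countable (\<Union>n. N n)" using N(1) by (auto intro: countable_finite)
    have "x \<in> closure (\<Union>n. N n)" for x
      unfolding closure_approachable
    proof (intro allI impI)
      fix e :: real assume "e > 0"
      then obtain n where n: "inverse (real (Suc n)) < e" using reals_Archimedean by blast
      obtain y where "y \<in> N n" "dist x y < inverse (real (Suc n))" using N(2) by blast
      with n show "\<exists>y\<in>\<Union>n. N n. dist y x < e"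
        by (intro bexI[of _ y]) (auto simp: dist_commute)
    qed
    then show "closure (\<Union>n. N n) = UNIV" by auto
  qed
qed

lemma apply_Bcontfun_compact:
  fixes f :: "'a::metric_space \<Rightarrow> real"
  assumes "compact (UNIV :: 'a set)" "continuous_on UNIV f"
  shows "apply_bcontfun (Bcontfun f) = f"
  using compact_imp_bounded[OF compact_continuous_image[OF assms(2,1)]] assms(2)
  by (intro Bcontfun_inverse) (auto simp: bcontfun_def)

text \<open>The functions used to show separability: a finite maximum of downward cones of common
  slope \<open>L\<close>, each with an apex height and an apex position.\<close>
definition cone_max :: "real \<Rightarrow> (real \<times> 'a::metric_space) list \<Rightarrow> 'a \<Rightarrow> real" where
  "cone_max L cs x = Max ((\<lambda>(q, d). q - L * dist x d) ` set cs)"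

lemma continuous_on_Max_image:
  fixes f :: "'i \<Rightarrow> 'a::topological_space \<Rightarrow> real"
  assumes "finite I" "I \<noteq> {}" "\<And>i. i \<in> I \<Longrightarrow> continuous_on S (f i)"
  shows "continuous_on S (\<lambda>x. Max ((\<lambda>i. f i x) ` I))"
  using assms
proof (induction I rule: finite_ne_induct)
  case (insert i I)
  then have "(\<lambda>x. Max ((\<lambda>i. f i x) ` insert i I)) = (\<lambda>x. max (f i x) (Max ((\<lambda>i. f i x) ` I)))"
    by auto
  then show ?case using insert by (auto intro!: continuous_on_max)
qed simp

text \<open>Cones with rational heights, apexes in a countable dense set and integer slopes suffice.
  Given \<open>f\<close>, put apexes just below the graph of \<open>f\<close> over a fine net. Near
  an apex uniform continuity compares the cone with \<open>f\<close>; far from it the cone has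
  already dropped below the minimum of \<open>f\<close>.\<close>
lemma bcontfun_countable_dense:
  assumes X: "compact (UNIV :: 'a::metric_space set)"
  shows "\<exists>D :: ('a \<Rightarrow>\<^sub>C real) set. countable D \<and> closure D = UNIV"
proof -
  obtain D :: "'a set" where D: "countable D" "closure D = UNIV"
    using compact_countable_dense[OF X] by blast
  define G where "G = (\<lambda>(n, cs). Bcontfun (cone_max (real n) cs)) `
    ((UNIV :: nat set) \<times> {cs. set cs \<subseteq> \<rat> \<times> D \<and> cs \<noteq> []})"
  have "countable {cs. set cs \<subseteq> \<rat> \<times> D \<and> cs \<noteq> []}"
    by (rule countable_subset[OF _ countable_lists[of "\<rat> \<times> D"]])
      (auto simp: lists_eq_set D countable_rat)
  then have "countable G"
    unfolding G_def by (intro countable_image countable_SIGMA) auto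
  moreover have "f \<in> closure G" for f :: "'a \<Rightarrow>\<^sub>C real"
    unfolding closure_approachable
  proof (intro allI impI)
    fix e0 :: real assume "e0 > 0"
    define e where "e = e0 / 4"
    have e: "e > 0" using \<open>e0 > 0\<close> by (simp add: e_def)
    obtain \<delta> where \<delta>: "\<delta> > 0" "\<And>x y. dist x y < \<delta> \<Longrightarrow> \<bar>f x - f y\<bar> < e"
      using compact_UNIV_uniformly_continuous[OF X _ e, of f] by auto
    \<comment> \<open>The slope is so steep that a cone with apex \<open>d\<close> is below \<open>f\<close> outside the \<open>\<delta>\<close>-ball around \<open>d\<close>.\<close>
    obtain n where n: "real n > (2 * norm f + e) / \<delta>" using reals_Archimedean2 by blast
    then have n\<delta>: "real n * \<delta> > 2 * norm f + e" using \<delta>(1) by (simp add: field_simps)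
    then have npos: "real n > 0" using \<delta>(1) e
      by (smt (verit) norm_ge_zero mult_nonpos_nonneg of_nat_0_le_iff)
    define \<rho> where "\<rho> = min \<delta> (e / real n)"
    have \<rho>: "\<rho> > 0" "\<rho> \<le> \<delta>" "real n * \<rho> \<le> e"
      using \<delta>(1) e npos by (auto simp: \<rho>_def min_def field_simps)
    obtain N where N: "finite N" "\<And>x :: 'a. \<exists>y\<in>N. dist x y < \<rho> / 2"
      using finite_net[OF X, of "\<rho> / 2"] \<rho>(1) by auto
    have "\<exists>d\<in>D. dist y d < \<rho> / 2" for y
      using D(2) \<rho>(1) by (metis UNIV_I closure_approachable dist_commute half_gt_zero)
    then obtain p where p: "\<And>y. p y \<in> D" "\<And>y. dist y (p y) < \<rho> / 2" by metis
    have "\<exists>q. q \<in> \<rat> \<and> f y - e < q \<and> q < f y" for y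
      using Rats_dense_in_real[of "f y - e" "f y"] e by auto
    then obtain q where q: "\<And>y. q y \<in> \<rat>" "\<And>y. f y - e < q y" "\<And>y. q y < f y" by metis
    obtain ys where ys: "set ys = N" using finite_list[OF N(1)] by blast
    define cs where "cs = map (\<lambda>y. (q (p y), p y)) ys"
    have Nne: "N \<noteq> {}" using N(2) by blast
    then have cs: "set cs = (\<lambda>y. (q (p y), p y)) ` N" "cs \<noteq> []"
      using ys by (auto simp: cs_def)
    define F where "F = cone_max (real n) cs"
    have F: "F x = Max ((\<lambda>y. q (p y) - real n * dist x (p y)) ` N)" for x
      unfolding F_def cone_max_def cs by (simp add: image_image)
    have Fc: "continuous_on UNIV F"
      unfolding F[abs_def] using N(1) Nne
      by (intro continuous_on_Max_image) (auto intro!: continuous_intros)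
    have lower: "F x \<ge> f x - 3 * e" for x
    proof -
      obtain y where y: "y \<in> N" "dist x y < \<rho> / 2" using N(2) by blast
      have d: "dist x (p y) < \<rho>" using y(2) p(2)[of y] dist_triangle[of x "p y" y] by linarith
      then have "real n * dist x (p y) \<le> real n * \<rho>" using npos by simp
      moreover have "\<bar>f x - f (p y)\<bar> < e" using \<delta>(2)[of x "p y"] d \<rho>(2) by simp
      moreover have "q (p y) - real n * dist x (p y) \<le> F x"
        unfolding F using N(1) y(1) by (intro Max_ge) auto
      ultimately show ?thesis using q(2)[of "p y"] \<rho>(3) by linarith
    qed
    have upper: "F x \<le> f x + e" for x
    proof -
      have "q (p y) - real n * dist x (p y) \<le> f x + e" for y
      proof (cases "dist x (p y) < \<delta>")
        case True
        then have "\<bar>f x - f (p y)\<bar> < e" using \<delta>(2)[of x "p y"] by simp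
        moreover have "0 \<le> real n * dist x (p y)" by simp
        ultimately show ?thesis using q(3)[of "p y"] by linarith
      next
        case False
        then have "real n * \<delta> \<le> real n * dist x (p y)" using npos by simp
        then show ?thesis
          using n\<delta> q(3)[of "p y"] norm_bounded[of f x] norm_bounded[of f "p y"] e
          by simp
      qed
      then show ?thesis unfolding F using N(1) Nne by (auto simp: Max_le_iff)
    qed
    have app: "apply_bcontfun (Bcontfun F) = F" by (rule apply_Bcontfun_compact[OF X Fc])
    have "dist (Bcontfun F) f \<le> 3 * e"
    proof (rule dist_bound)
      fix x show "dist (Bcontfun F x) (f x) \<le> 3 * e"
        using lower[of x] upper[of x] e by (simp add: app dist_real_def)
    qed
    moreover have "Bcontfun F \<in> G"
      unfolding G_def F_def using q(1) p(1) cs by (force intro!: image_eqI[of _ _ "(n, cs)"])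
    ultimately show "\<exists>g\<in>G. dist g f < e0" using e by (intro bexI[of _ "Bcontfun F"]) (auto simp: e_def)
  qed
  ultimately show ?thesis by blast
qed

section \<open>Densities of tropical linear functionals\<close>

lemma tropical_linear_mono:
  assumes "tropical_linear l" "\<And>x. apply_bcontfun f x \<le> apply_bcontfun g x"
  shows "l f \<le> l g"
proof -
  have "bcont_max f g = g"
    by (rule bcontfun_eqI) (use assms(2) in \<open>simp add: max_def\<close>)
  then have "l g = max (l f) (l g)"
    using assms(1) unfolding tropical_linear_def by metis
  then show ?thesis by simp
qed

lemma tropical_linear_finite_upper_bound:
  assumes l: "tropical_linear l" and "finite I" "I \<noteq> {}" "\<And>i. i \<in> I \<Longrightarrow> l (k i) < c"
  shows "\<exists>h. (\<forall>i\<in>I. \<forall>x. apply_bcontfun (k i) x \<le> apply_bcontfun h x) \<and> l h < c"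
  using assms(2-)
proof (induction I rule: finite_ne_induct)
  case (singleton i)
  then show ?case by blast
next
  case (insert i I)
  then obtain h where h: "\<And>j x. j \<in> I \<Longrightarrow> apply_bcontfun (k j) x \<le> apply_bcontfun h x" "l h < c" by auto
  show ?case
  proof (intro exI[of _ "bcont_max (k i) h"] conjI ballI allI)
    fix j x assume "j \<in> insert i I"
    then show "apply_bcontfun (k j) x \<le> bcont_max (k i) h x"
      using h(1)[of j x] by (cases "j = i") auto
  next
    show "l (bcont_max (k i) h) < c"
      using l h(2) insert.prems[of i] unfolding tropical_linear_def by simp
  qed
qed

text \<open>A density \<open>b\<close> of \<open>l\<close> satisfies \<open>f x + b x \<le> l
  f\<close> for every \<open>f\<close>. This function is the largest one that does.\<close>
definition maximal_density :: "(('a::topological_space \<Rightarrow>\<^sub>C real) \<Rightarrow> real) \<Rightarrow> 'a \<Rightarrow> ereal" where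
  "maximal_density l x = (INF f. ereal (l f - apply_bcontfun f x))"

text \<open>Only the bound of \<open>l f\<close> by the supremum needs an argument. If \<open>c < l
  f\<close> were above the supremum, then each point \<open>x\<close> would have a test function
  that exceeds \<open>f\<close> at \<open>x\<close> although \<open>l\<close> is below
  \<open>c\<close> on it. By compactness the maximum of finitely many of them exceeds
  \<open>f\<close> everywhere, and \<open>l\<close> is still below \<open>c\<close> on that maximum,
  against monotonicity.\<close>
lemma tropical_density_maximal_density:
  assumes X: "compact (UNIV :: 'a::metric_space set)"
    and l: "tropical_linear (l :: ('a \<Rightarrow>\<^sub>C real) \<Rightarrow> real)"
  shows "tropical_density l (maximal_density l)"
  unfolding tropical_density_def
proof (intro conjI allI)
  have "maximal_density l x \<le> ereal (l 0)" for x
    unfolding maximal_density_def by (rule INF_lower2[of 0]) auto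
  then have "maximal_density l x \<noteq> \<infinity>" for x
    by (metis ereal_infty_less_eq(1) PInfty_neq_ereal(1))
  moreover have "upper_semicontinuous (maximal_density l)"
    unfolding upper_semicontinuous_def
  proof
    fix c
    have "{x. maximal_density l x < c} = (\<Union>f. {x. ereal (l f - apply_bcontfun f x) < c})"
      by (auto simp: maximal_density_def INF_less_iff)
    moreover have "open {x. ereal (l f - apply_bcontfun f x) < c}" for f
      by (intro open_Collect_less continuous_intros continuous_on_ereal) auto
    ultimately show "open {x. maximal_density l x < c}" by auto
  qed
  ultimately show "maximal_density l \<in> D_max" by (auto simp: D_max_def)
next
  fix f :: "'a \<Rightarrow>\<^sub>C real"
  show "ereal (l f) = (SUP x. ereal (f x) + maximal_density l x)"
  proof (rule antisym)
    show "(SUP x. ereal (f x) + maximal_density l x) \<le> ereal (l f)"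
    proof (rule SUP_least)
      fix x
      have "maximal_density l x \<le> ereal (l f - f x)"
        unfolding maximal_density_def by (rule INF_lower) auto
      then show "ereal (f x) + maximal_density l x \<le> ereal (l f)"
        by (cases "maximal_density l x") auto
    qed
  next
    show "ereal (l f) \<le> (SUP x. ereal (f x) + maximal_density l x)"
    proof (rule ccontr)
      assume "\<not> ?thesis"
      then obtain q where q: "(SUP x. ereal (f x) + maximal_density l x) < ereal (real_of_rat q)"
        "ereal (real_of_rat q) < ereal (l f)"
        using ereal_dense3[of "SUP x. ereal (f x) + maximal_density l x" "ereal (l f)"]
        by (auto simp: not_le)
      define c where "c = real_of_rat q"
      have "\<exists>k. l k < c \<and> f x < apply_bcontfun k x" for x :: 'a
      proof -
        have "ereal (f x) + maximal_density l x \<le> (SUP x. ereal (f x) + maximal_density l x)"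
          by (rule SUP_upper) auto
        then have "ereal (f x) + maximal_density l x < ereal c"
          using q(1) by (simp add: c_def)
        then have "maximal_density l x < ereal (c - f x)"
          by (cases "maximal_density l x") auto
        then obtain h where h: "l h - apply_bcontfun h x < c - f x"
          unfolding maximal_density_def INF_less_iff by auto
        \<comment> \<open>Half of the gap lifts the test function above \<open>f\<close> at \<open>x\<close>, the other half keeps its value below \<open>c\<close>.\<close>
        define s where "s = (c - f x - (l h - h x)) / 2"
        have "l (const_bcontfun (f x - h x + s) + h) = f x - h x + s + l h"
          using l by (simp add: tropical_linear_def)
        moreover have "s > 0" using h by (simp add: s_def)
        ultimately show ?thesis
          by (intro exI[of _ "const_bcontfun (f x - h x + s) + h"])
            (auto simp: s_def field_simps)
      qed
      then obtain k where k: "\<And>x. l (k x) < c" "\<And>x. f x < apply_bcontfun (k x) x" by metis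
      have "open {y. f y < k x y}" for x
        by (intro open_Collect_less) auto
      then obtain I where I: "finite I" "\<And>y. \<exists>x\<in>I. y \<in> {y. f y < k x y}"
        using compact_UNIV_finite_subcover[OF X, of "\<lambda>x. {y. f y < k x y}"] k(2) by blast
      then have "I \<noteq> {}" by blast
      then obtain h where h: "\<And>x y. x \<in> I \<Longrightarrow> k x y \<le> apply_bcontfun h y" "l h < c"
        using tropical_linear_finite_upper_bound[OF l I(1), of k c] k(1) by auto
      have "f y \<le> h y" for y
      proof -
        obtain x where "x \<in> I" "f y < k x y" using I(2)[of y] by auto
        with h(1)[of x y] show ?thesis by simp
      qed
      then have "l f \<le> l h" by (rule tropical_linear_mono[OF l])
      with h(2) q(2) show False by (simp add: c_def)
    qed
  qed
qed

text \<open>A density lies below the maximal one by definition. For the converse at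
  \<open>x0\<close>, test with a steep downward cone at \<open>x0\<close>: semicontinuity controls
  \<open>b\<close> near \<open>x0\<close>, and away from \<open>x0\<close> the cone outweighs the
  global upper bound \<open>l 0\<close> of \<open>b\<close>.\<close>
lemma tropical_density_unique:
  assumes X: "compact (UNIV :: 'a::metric_space set)"
    and b: "tropical_density (l :: ('a \<Rightarrow>\<^sub>C real) \<Rightarrow> real) b"
  shows "b = maximal_density l"
proof
  fix x0
  have lf: "ereal (l f) = (SUP x. ereal (apply_bcontfun f x) + b x)" for f
    using b by (simp add: tropical_density_def)
  have le: "ereal (apply_bcontfun f x) + b x \<le> ereal (l f)" for f x
    unfolding lf by (rule SUP_upper) auto
  have b_le: "b x \<le> ereal (l f - apply_bcontfun f x)" for f x
    using le[of f x] by (cases "b x") auto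
  have "upper_semicontinuous b"
    using b b_le[of _ 0] by (auto simp: tropical_density_def D_max_def)
  show "b x0 = maximal_density l x0"
  proof (rule antisym)
    show "b x0 \<le> maximal_density l x0"
      unfolding maximal_density_def by (intro INF_greatest b_le)
    show "maximal_density l x0 \<le> b x0"
    proof (rule ccontr)
      assume "\<not> ?thesis"
      then obtain q where q: "b x0 < ereal (real_of_rat q)" "ereal (real_of_rat q) < maximal_density l x0"
        using ereal_dense3[of "b x0" "maximal_density l x0"] by (auto simp: not_le)
      define c where "c = real_of_rat q"
      have "open {x. b x < ereal c}"
        using \<open>upper_semicontinuous b\<close> by (auto simp: upper_semicontinuous_def)
      then obtain \<delta> where \<delta>: "\<delta> > 0" "\<And>x. dist x0 x < \<delta> \<Longrightarrow> b x < ereal c"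
        using q(1) unfolding c_def open_contains_ball by (auto simp: subset_iff)
      \<comment> \<open>With slope \<open>n\<close> the cone is below \<open>c - l 0\<close>
        outside the \<open>\<delta>\<close>-ball around \<open>x0\<close>.\<close>
      obtain n where n: "real n > (l 0 - c) / \<delta>" using reals_Archimedean2 by blast
      define f where "f = Bcontfun (\<lambda>x. - real n * dist x x0)"
      have f: "f x = - real n * dist x x0" for x
        unfolding f_def by (subst apply_Bcontfun_compact[OF X]) (auto intro!: continuous_intros)
      have "ereal (l f) \<le> ereal c"
        unfolding lf
      proof (rule SUP_least)
        fix x
        show "ereal (f x) + b x \<le> ereal c"
        proof (cases "dist x0 x < \<delta>")
          case True
          have "f x \<le> 0" by (simp add: f)
          then show ?thesis
            using \<delta>(2)[OF True] by (cases "b x") auto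
        next
          case False
          have "real n * \<delta> \<le> real n * dist x x0"
            using False by (intro mult_left_mono) (auto simp: dist_commute)
          moreover have "l 0 - c < real n * \<delta>"
            using n \<delta>(1) by (simp add: field_simps)
          ultimately have "f x \<le> c - l 0" by (simp add: f)
          then show ?thesis
            using b_le[of x 0] by (cases "b x") auto
        qed
      qed
      moreover have "maximal_density l x0 \<le> ereal (l f - f x0)"
        unfolding maximal_density_def by (rule INF_lower) auto
      ultimately have "maximal_density l x0 \<le> ereal c"
        using f[of x0] by (simp add: order_trans)
      with q(2) show False by (simp add: c_def)
    qed
  qed
qed

section \<open>Borel probability measures on compact metric spaces\<close>

lemma borel_probD:
  assumes "borel_prob M"
  shows "prob_space M" "sets M = sets borel" "space M = UNIV"
  using assms sets_eq_imp_space_eq[of M borel] unfolding borel_prob_def by auto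

lemma borel_prob_measurable:
  fixes f :: "'a::topological_space \<Rightarrow> 'b::topological_space"
  assumes "borel_prob M" "continuous_on UNIV f"
  shows "f \<in> borel_measurable M"
  using borel_measurable_continuous_onI[OF assms(2)] borel_probD(2)[OF assms(1)]
    measurable_cong_sets by blast

lemma borel_prob_integrable:
  fixes f :: "'a::metric_space \<Rightarrow> real"
  assumes X: "compact (UNIV :: 'a set)" and M: "borel_prob M" and f: "continuous_on UNIV f"
  shows "integrable M f"
proof -
  interpret prob_space M by (rule borel_probD(1)[OF M])
  obtain B where "\<And>x. norm (f x) \<le> B"
    using compact_imp_bounded[OF compact_continuous_image[OF f X]] by (auto simp: bounded_iff)
  then show ?thesis
    by (intro integrable_const_bound[of _ B] borel_prob_measurable[OF M f]) auto
qed

text \<open>The integrands decrease to the indicator of \<open>C\<close>, so continuous integrands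
  determine the measure of closed sets.\<close>
lemma borel_prob_closed_limit:
  fixes M :: "'a::metric_space measure"
  assumes M: "borel_prob M" and C: "closed C" "C \<noteq> {}"
  shows "(\<lambda>n. \<integral>x. max 0 (1 - real n * infdist x C) \<partial>M) \<longlonglongrightarrow> measure M C"
proof -
  interpret prob_space M by (rule borel_probD(1)[OF M])
  have Cs: "C \<in> sets M" using C(1) borel_probD(2)[OF M] by simp
  have "(\<lambda>n. \<integral>x. max 0 (1 - real n * infdist x C) \<partial>M) \<longlonglongrightarrow> (\<integral>x. indicator C x \<partial>M)"
  proof (rule integral_dominated_convergence)
    show "(indicator C :: 'a \<Rightarrow> real) \<in> borel_measurable M" using Cs by simp
    show "(\<lambda>x. max 0 (1 - real n * infdist x C)) \<in> borel_measurable M" for n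
      by (intro borel_prob_measurable[OF M] continuous_intros)
    show "integrable M (\<lambda>x. 1 :: real)" by simp
    show "AE x in M. norm (max 0 (1 - real n * infdist x C)) \<le> 1" for n
      by (intro AE_I2) (simp add: infdist_nonneg)
    show "AE x in M. (\<lambda>n. max 0 (1 - real n * infdist x C)) \<longlonglongrightarrow> indicator C x"
    proof (intro AE_I2)
      fix x
      show "(\<lambda>n. max 0 (1 - real n * infdist x C)) \<longlonglongrightarrow> indicator C x"
      proof (cases "x \<in> C")
        case True
        then show ?thesis by (simp add: infdist_zero)
      next
        case False
        then have pos: "infdist x C > 0"
          using in_closed_iff_infdist_zero[OF C] infdist_nonneg[of x C] by force
        obtain n0 where n0: "1 / infdist x C < real n0" using reals_Archimedean2 by blast
        have "max 0 (1 - real n * infdist x C) = 0" if "n \<ge> n0" for n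
        proof -
          have "1 / infdist x C < real n" using n0 that by linarith
          then show ?thesis using pos by (simp add: field_simps)
        qed
        then have "eventually (\<lambda>n. max 0 (1 - real n * infdist x C) = 0) sequentially"
          by (auto simp: eventually_sequentially)
        then show ?thesis using False by (auto intro: tendsto_eventually)
      qed
    qed
  qed
  then show ?thesis using Cs by simp
qed

text \<open>Closed sets form an intersection-stable generator of the Borel sets.\<close>
lemma borel_prob_eqI:
  fixes M N :: "'a::metric_space measure"
  assumes M: "borel_prob M" and N: "borel_prob N"
    and eq: "\<And>f :: 'a \<Rightarrow> real. continuous_on UNIV f \<Longrightarrow> (\<integral>x. f x \<partial>M) = (\<integral>x. f x \<partial>N)"
  shows "M = N"
proof (rule measure_eqI_generator_eq)
  interpret M: prob_space M by (rule borel_probD(1)[OF M])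
  interpret N: prob_space N by (rule borel_probD(1)[OF N])
  show "Int_stable (Collect closed :: 'a set set)" by (auto simp: Int_stable_def)
  show "Collect closed \<subseteq> Pow (UNIV :: 'a set)" by simp
  have "sets borel = sigma_sets UNIV (Collect closed :: 'a set set)"
    by (simp add: borel_eq_closed)
  then show "sets M = sigma_sets UNIV (Collect closed)" "sets N = sigma_sets UNIV (Collect closed)"
    using borel_probD(2)[OF M] borel_probD(2)[OF N] by auto
  show "range (\<lambda>_::nat. UNIV) \<subseteq> (Collect closed :: 'a set set)" by auto
  show "(\<Union>i::nat. UNIV) = (UNIV :: 'a set)" by simp
  show "emeasure M UNIV \<noteq> \<infinity>" by simp
  fix C :: "'a set" assume "C \<in> Collect closed"
  then have C: "closed C" by simp
  show "emeasure M C = emeasure N C"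
  proof (cases "C = {}")
    case False
    have "(\<integral>x. max 0 (1 - real n * infdist x C) \<partial>M) = (\<integral>x. max 0 (1 - real n * infdist x C) \<partial>N)" for n
      by (intro eq continuous_intros)
    then have "measure M C = measure N C"
      using borel_prob_closed_limit[OF M C False] borel_prob_closed_limit[OF N C False]
      by (simp add: LIMSEQ_unique)
    then show ?thesis by (simp add: M.emeasure_eq_measure N.emeasure_eq_measure)
  qed simp
qed

section \<open>Log-Laplace functionals\<close>

lemma bcont_exp_continuous:
  fixes f :: "'a::topological_space \<Rightarrow>\<^sub>C real" and \<beta> :: real
  shows "continuous_on UNIV (\<lambda>x. exp (\<beta> * apply_bcontfun f x))"
  by (intro continuous_intros) auto

lemma exp_integral_pos:
  fixes f :: "'a::metric_space \<Rightarrow>\<^sub>C real"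
  assumes X: "compact (UNIV :: 'a set)" and \<mu>: "borel_prob \<mu>"
  shows "0 < (\<integral>x. exp (\<beta> * f x) \<partial>\<mu>)"
proof -
  interpret prob_space \<mu> by (rule borel_probD(1)[OF \<mu>])
  have "0 < exp (- (\<bar>\<beta>\<bar> * norm f))" by simp
  also have "\<dots> = (\<integral>x. exp (- (\<bar>\<beta>\<bar> * norm f)) \<partial>\<mu>)" using prob_space by simp
  also have "\<dots> \<le> (\<integral>x. exp (\<beta> * f x) \<partial>\<mu>)"
  proof (rule integral_mono)
    fix x
    have "\<bar>\<beta> * f x\<bar> \<le> \<bar>\<beta>\<bar> * norm f"
      using norm_bounded[of f x] by (simp add: abs_mult mult_left_mono)
    then show "exp (- (\<bar>\<beta>\<bar> * norm f)) \<le> exp (\<beta> * f x)" by simp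
  qed (auto intro: borel_prob_integrable[OF X \<mu>] bcont_exp_continuous)
  finally show ?thesis .
qed

lemma exp_log_laplace:
  fixes f :: "'a::metric_space \<Rightarrow>\<^sub>C real"
  assumes "compact (UNIV :: 'a set)" "borel_prob \<mu>" "\<beta> > 0"
  shows "exp (\<beta> * log_laplace \<beta> \<mu> f) = (\<integral>x. exp (\<beta> * f x) \<partial>\<mu>)"
  using exp_integral_pos[OF assms(1,2)] assms(3) by (simp add: log_laplace_def)

lemma log_laplace_le_iff:
  fixes f h :: "'a::metric_space \<Rightarrow>\<^sub>C real"
  assumes "compact (UNIV :: 'a set)" "borel_prob \<mu>" "\<beta> > 0"
  shows "log_laplace \<beta> \<mu> f \<le> log_laplace \<beta> \<mu> h + c \<longleftrightarrow>
    (\<integral>x. exp (\<beta> * f x) \<partial>\<mu>) \<le> exp (\<beta> * c) * (\<integral>x. exp (\<beta> * h x) \<partial>\<mu>)"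
proof -
  have "log_laplace \<beta> \<mu> f \<le> log_laplace \<beta> \<mu> h + c \<longleftrightarrow>
      \<beta> * log_laplace \<beta> \<mu> f \<le> \<beta> * c + \<beta> * log_laplace \<beta> \<mu> h"
    using assms(3) by (simp add: distrib_left[symmetric] add.commute)
  also have "\<dots> \<longleftrightarrow> exp (\<beta> * log_laplace \<beta> \<mu> f) \<le> exp (\<beta> * c) * exp (\<beta> * log_laplace \<beta> \<mu> h)"
    by (simp add: exp_add[symmetric])
  finally show ?thesis by (simp add: exp_log_laplace[OF assms])
qed

text \<open>The source of the monotonicity, the translation rule and the Lipschitz bound
  below.\<close>
lemma log_laplace_mono_shift:
  fixes f h :: "'a::metric_space \<Rightarrow>\<^sub>C real"
  assumes X: "compact (UNIV :: 'a set)" and \<mu>: "borel_prob \<mu>" and \<beta>: "\<beta> > 0"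
    and le: "\<And>x. f x \<le> h x + c"
  shows "log_laplace \<beta> \<mu> f \<le> log_laplace \<beta> \<mu> h + c"
proof -
  note int = borel_prob_integrable[OF X \<mu> bcont_exp_continuous]
  have "(\<integral>x. exp (\<beta> * f x) \<partial>\<mu>) \<le> (\<integral>x. exp (\<beta> * c) * exp (\<beta> * h x) \<partial>\<mu>)"
  proof (rule integral_mono)
    fix x
    have "\<beta> * f x \<le> \<beta> * (h x + c)" using le[of x] \<beta> by (intro mult_left_mono) auto
    then show "exp (\<beta> * f x) \<le> exp (\<beta> * c) * exp (\<beta> * h x)"
      by (simp add: exp_add[symmetric] algebra_simps)
  qed (use int in auto)
  then show ?thesis by (simp add: log_laplace_le_iff[OF X \<mu> \<beta>])
qed

lemma log_laplace_Lipschitz: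
  fixes f h :: "'a::metric_space \<Rightarrow>\<^sub>C real"
  assumes "compact (UNIV :: 'a set)" "borel_prob \<mu>" "\<beta> > 0"
  shows "\<bar>log_laplace \<beta> \<mu> f - log_laplace \<beta> \<mu> h\<bar> \<le> dist f h"
proof -
  have d: "\<bar>f x - h x\<bar> \<le> dist f h" for x
    using dist_bounded[of f x h] by (simp add: dist_real_def)
  have le: "f x \<le> h x + dist f h" "h x \<le> f x + dist f h" for x
    using d[of x] by linarith+
  show ?thesis
    using log_laplace_mono_shift[OF assms le(1)] log_laplace_mono_shift[OF assms le(2)] by linarith
qed

lemma log_laplace_zero:
  assumes "borel_prob \<mu>"
  shows "log_laplace \<beta> \<mu> 0 = 0"
proof -
  interpret prob_space \<mu> by (rule borel_probD(1)[OF assms])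
  show ?thesis by (simp add: log_laplace_def prob_space)
qed

lemma log_laplace_const:
  fixes f :: "'a::metric_space \<Rightarrow>\<^sub>C real"
  assumes "compact (UNIV :: 'a set)" "borel_prob \<mu>" "\<beta> > 0"
  shows "log_laplace \<beta> \<mu> (const_bcontfun c + f) = c + log_laplace \<beta> \<mu> f"
  using log_laplace_mono_shift[OF assms, of "const_bcontfun c + f" f c]
    log_laplace_mono_shift[OF assms, of f "const_bcontfun c + f" "- c"] by simp

text \<open>The second inequality loses \<open>ln 2 / \<beta>\<close> because a maximum of two
  exponentials is replaced by their sum.\<close>
lemma log_laplace_max:
  fixes f h :: "'a::metric_space \<Rightarrow>\<^sub>C real"
  assumes X: "compact (UNIV :: 'a set)" and \<mu>: "borel_prob \<mu>" and \<beta>: "\<beta> > 0"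
  shows "max (log_laplace \<beta> \<mu> f) (log_laplace \<beta> \<mu> h) \<le> log_laplace \<beta> \<mu> (bcont_max f h)"
    and "log_laplace \<beta> \<mu> (bcont_max f h) \<le> max (log_laplace \<beta> \<mu> f) (log_laplace \<beta> \<mu> h) + ln 2 / \<beta>"
proof -
  note mono = log_laplace_mono_shift[OF X \<mu> \<beta>, where c = 0]
  note int = borel_prob_integrable[OF X \<mu> bcont_exp_continuous]
  show "max (log_laplace \<beta> \<mu> f) (log_laplace \<beta> \<mu> h) \<le> log_laplace \<beta> \<mu> (bcont_max f h)"
    using mono[of f "bcont_max f h"] mono[of h "bcont_max f h"] by simp
  define M where "M = max (log_laplace \<beta> \<mu> f) (log_laplace \<beta> \<mu> h)"
  have "exp (\<beta> * log_laplace \<beta> \<mu> (bcont_max f h)) = (\<integral>x. exp (\<beta> * bcont_max f h x) \<partial>\<mu>)"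
    by (rule exp_log_laplace[OF assms])
  also have "\<dots> \<le> (\<integral>x. exp (\<beta> * f x) + exp (\<beta> * h x) \<partial>\<mu>)"
  proof (rule integral_mono)
    fix x show "exp (\<beta> * bcont_max f h x) \<le> exp (\<beta> * f x) + exp (\<beta> * h x)"
      by (simp add: max_def)
  qed (use int[of \<beta> "bcont_max f h"] int[of \<beta> f] int[of \<beta> h] in \<open>simp_all del: apply_bcont_max\<close>)
  also have "\<dots> = exp (\<beta> * log_laplace \<beta> \<mu> f) + exp (\<beta> * log_laplace \<beta> \<mu> h)"
    using int by (simp add: exp_log_laplace[OF assms])
  also have "\<dots> \<le> exp (\<beta> * M) + exp (\<beta> * M)"
    using \<beta> by (intro add_mono) (auto simp: M_def)
  also have "\<dots> = exp (\<beta> * (M + ln 2 / \<beta>))"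
    using \<beta> by (simp add: distrib_left exp_add)
  finally have "log_laplace \<beta> \<mu> (bcont_max f h) \<le> M + ln 2 / \<beta>"
    using \<beta> by simp
  then show "log_laplace \<beta> \<mu> (bcont_max f h) \<le> max (log_laplace \<beta> \<mu> f) (log_laplace \<beta> \<mu> h) + ln 2 / \<beta>"
    by (simp add: M_def)
qed

lemma tropical_linear_limit:
  fixes \<mu> :: "nat \<Rightarrow> 'a::metric_space measure"
  assumes X: "compact (UNIV :: 'a set)" and \<mu>: "\<And>k. borel_prob (\<mu> k)"
    and \<beta>: "\<And>k. \<beta> k > 0" "filterlim \<beta> at_top sequentially"
    and lim: "\<And>f. (\<lambda>k. log_laplace (\<beta> k) (\<mu> k) f) \<longlonglongrightarrow> l f"
  shows "tropical_linear l"
  unfolding tropical_linear_def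
proof (intro conjI allI)
  fix c :: real and f :: "'a \<Rightarrow>\<^sub>C real"
  have "(\<lambda>k. c + log_laplace (\<beta> k) (\<mu> k) f) \<longlonglongrightarrow> c + l f"
    by (intro tendsto_intros lim)
  then show "l (const_bcontfun c + f) = c + l f"
    using lim[of "const_bcontfun c + f"] LIMSEQ_unique
    by (simp add: log_laplace_const[OF X \<mu> \<beta>(1)])
next
  fix f h :: "'a \<Rightarrow>\<^sub>C real"
  let ?M = "\<lambda>k. max (log_laplace (\<beta> k) (\<mu> k) f) (log_laplace (\<beta> k) (\<mu> k) h)"
  have M: "?M \<longlonglongrightarrow> max (l f) (l h)" by (intro tendsto_max lim)
  have "(\<lambda>k. ln 2 / \<beta> k) \<longlonglongrightarrow> 0"
    by (intro real_tendsto_divide_at_top[OF tendsto_const \<beta>(2)])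
  from tendsto_add[OF M this] have U: "(\<lambda>k. ?M k + ln 2 / \<beta> k) \<longlonglongrightarrow> max (l f) (l h)" by simp
  have "(\<lambda>k. log_laplace (\<beta> k) (\<mu> k) (bcont_max f h)) \<longlonglongrightarrow> max (l f) (l h)"
    by (rule tendsto_sandwich[OF _ _ M U]; intro always_eventually allI log_laplace_max X \<mu> \<beta>(1))
  then show "l (bcont_max f h) = max (l f) (l h)"
    using lim LIMSEQ_unique by blast
qed

section \<open>Inverse branches of expanding coverings\<close>

text \<open>The constants of an expanding covering map on a compact space. Expansion holds below the
  scale \<open>2 * eta\<close>, and \<open>xi\<close> is a radius on which every point has an
  inverse branch staying within \<open>eta\<close>.\<close>
locale expanding_system =
  fixes T :: "'a::metric_space \<Rightarrow> 'a" and lam eta xi :: real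
  assumes compact_space: "compact (UNIV :: 'a set)"
    and cont: "continuous_on UNIV T"
    and trans: "topologically_transitive T"
    and lam: "lam > 1" and eta: "eta > 0" and xi: "xi > 0"
    and expand: "\<And>x y. dist x y \<le> 2 * eta \<Longrightarrow> lam * dist x y \<le> dist (T x) (T y)"
    and lift: "\<And>z y. dist (T z) y < xi \<Longrightarrow> \<exists>w. T w = y \<and> dist z w < eta"
    and surjT: "surj T"

text \<open>Openness of \<open>T\<close> gives each point \<open>z\<close> a radius on which
  \<open>T\<close> can be inverted near \<open>z\<close>. A finite subcover makes the radius
  uniform; the half radii leave room to move from a point to the nearby centre.\<close>
lemma expanding_covering_map_system:
  fixes T :: "'a::metric_space \<Rightarrow> 'a"
  assumes X: "compact (UNIV :: 'a set)"
    and T: "expanding_covering_map T" "topologically_transitive T"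
  shows "\<exists>lam eta xi. expanding_system T lam eta xi"
proof -
  have op: "\<And>U. open U \<Longrightarrow> open (T ` U)" and cont: "continuous_on UNIV T" and "surj T"
    using T(1) unfolding expanding_covering_map_def by auto
  obtain lam eta where e: "lam > 1" "eta > 0"
    "\<And>x y. dist x y \<le> 2 * eta \<Longrightarrow> dist (T x) (T y) \<ge> lam * dist x y"
    using T(1) unfolding expanding_covering_map_def distance_expanding_def by blast
  have "\<exists>r>0. ball (T z) r \<subseteq> T ` ball z (eta / 2)" for z
  proof -
    have "open (T ` ball z (eta / 2))" "T z \<in> T ` ball z (eta / 2)"
      using op e(2) by auto
    then show ?thesis using open_contains_ball by blast
  qed
  then obtain r where r: "\<And>z. r z > 0" "\<And>z. ball (T z) (r z) \<subseteq> T ` ball z (eta / 2)" by metis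
  define V where "V z = ball z (eta / 2) \<inter> T -` ball (T z) (r z / 2)" for z
  have "open (V z)" for z
    unfolding V_def using continuous_open_vimage[of "ball (T z) (r z / 2)" T] cont
    by (auto simp: continuous_on_eq_continuous_at)
  moreover have "z \<in> V z" for z
    unfolding V_def using r(1) e(2) by auto
  ultimately obtain I where I: "finite I" "\<And>y. \<exists>z\<in>I. y \<in> V z"
    using compact_UNIV_finite_subcover[OF X, of V] by blast
  then have Ine: "I \<noteq> {}" by blast
  define xi where "xi = Min ((\<lambda>z. r z / 2) ` I)"
  have xi: "xi > 0" "\<And>z. z \<in> I \<Longrightarrow> xi \<le> r z / 2"
    unfolding xi_def using I(1) Ine r(1) by (simp, intro Min_le) auto
  have "\<exists>w. T w = y \<and> dist z w < eta" if zy: "dist (T z) y < xi" for z y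
  proof -
    obtain p where p: "p \<in> I" "z \<in> V p" using I(2)[of z] by auto
    then have "dist p z < eta / 2" "dist (T p) (T z) < r p / 2" by (auto simp: V_def)
    then have "dist (T p) y < r p"
      using zy xi(2)[OF p(1)] dist_triangle[of "T p" y "T z"] by linarith
    then obtain w where "w \<in> ball p (eta / 2)" "T w = y" using r(2)[of p] by auto
    moreover from this have "dist z w < eta"
      using \<open>dist p z < eta / 2\<close> dist_triangle2[of z w p] by (auto simp: dist_commute)
    ultimately show ?thesis by blast
  qed
  then have "expanding_system T lam eta xi"
    using X cont T(2) e xi(1) \<open>surj T\<close> by unfold_locales auto
  then show ?thesis by blast
qed

context expanding_system
begin

lemma contracting_lift:
  assumes "dist (T z) y < xi"
  shows "\<exists>w. T w = y \<and> dist z w < eta \<and> dist z w \<le> dist (T z) y / lam"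
proof -
  obtain w where w: "T w = y" "dist z w < eta" using lift[OF assms] by blast
  then have "lam * dist z w \<le> dist (T z) y" using expand[of z w] eta by auto
  then show ?thesis using w lam by (intro exI[of _ w]) (auto simp: field_simps)
qed

lemma fibre_separated:
  assumes "T z = T w" "dist z w \<le> 2 * eta"
  shows "z = w"
  using expand[OF assms(2)] assms(1) lam by (auto simp: mult_le_0_iff)

text \<open>Points of a fibre are more than \<open>2 * eta\<close> apart, so each ball of an
  \<open>eta\<close>-net contains at most one of them.\<close>
lemma fibre_card_bound: "\<exists>N. \<forall>x. finite (T -` {x}) \<and> card (T -` {x}) \<le> N"
proof -
  obtain C :: "'a set" where C: "finite C" "\<And>x. \<exists>c\<in>C. dist x c < eta"
    using finite_net[OF compact_space eta] by auto
  then obtain c where c: "\<And>x. c x \<in> C" "\<And>x. dist x (c x) < eta" by metis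
  have inj: "inj_on c (T -` {x})" for x
  proof (rule inj_onI)
    fix z w assume zw: "z \<in> T -` {x}" "w \<in> T -` {x}" "c z = c w"
    have "dist z w \<le> 2 * eta"
      using c(2)[of z] c(2)[of w] zw(3) dist_triangle2[of z w "c z"] by auto
    then show "z = w" using zw fibre_separated by auto
  qed
  have "finite (T -` {x}) \<and> card (T -` {x}) \<le> card C" for x
  proof
    have sub: "c ` (T -` {x}) \<subseteq> C" using c(1) by auto
    show "finite (T -` {x})" by (rule inj_on_finite[OF inj sub C(1)])
    show "card (T -` {x}) \<le> card C" by (rule card_inj_on_le[OF inj sub C(1)])
  qed
  then show ?thesis by blast
qed

lemma finite_fibre: "finite (T -` {x})"
  using fibre_card_bound by blast

lemma fibre_nonempty: "T -` {x} \<noteq> {}"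
  using surjT by (metis empty_iff insertI1 surj_def vimage_eq)

text \<open>Inverse branches pair the fibre over \<open>x\<close> injectively with points of the
  fibre over \<open>y\<close>, since two points of a fibre cannot both be within \<open>eta\<close>
  of the same point. This one-sided comparison suffices for sums of nonnegative terms, and
  exchanging \<open>x\<close> and \<open>y\<close> gives the other side.\<close>
lemma fibre_sum_le:
  fixes \<psi> \<theta> :: "'a \<Rightarrow> real"
  assumes xy: "dist x y < xi"
    and le: "\<And>z w. T z = x \<Longrightarrow> T w = y \<Longrightarrow> dist z w \<le> dist x y / lam \<Longrightarrow> \<psi> z \<le> \<theta> w"
    and nonneg: "\<And>w. T w = y \<Longrightarrow> 0 \<le> \<theta> w"
  shows "(\<Sum>z\<in>T -` {x}. \<psi> z) \<le> (\<Sum>w\<in>T -` {y}. \<theta> w)"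
proof -
  have "\<exists>w. T z = x \<longrightarrow> T w = y \<and> dist z w < eta \<and> dist z w \<le> dist x y / lam" for z
    using contracting_lift[of z y] xy by auto
  then obtain p where "\<forall>z. T z = x \<longrightarrow> T (p z) = y \<and> dist z (p z) < eta \<and> dist z (p z) \<le> dist x y / lam"
    by metis
  then have p: "\<And>z. T z = x \<Longrightarrow> T (p z) = y" "\<And>z. T z = x \<Longrightarrow> dist z (p z) < eta"
    "\<And>z. T z = x \<Longrightarrow> dist z (p z) \<le> dist x y / lam"
    by auto
  have inj: "inj_on p (T -` {x})"
  proof (rule inj_onI)
    fix z w assume zw: "z \<in> T -` {x}" "w \<in> T -` {x}" "p z = p w"
    have "dist z w \<le> 2 * eta"
      using p(2)[of z] p(2)[of w] zw dist_triangle2[of z w "p z"] by auto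
    then show "z = w" using zw fibre_separated by auto
  qed
  have "(\<Sum>z\<in>T -` {x}. \<psi> z) \<le> (\<Sum>z\<in>T -` {x}. \<theta> (p z))"
    using p by (intro sum_mono le) auto
  also have "\<dots> = (\<Sum>w\<in>p ` (T -` {x}). \<theta> w)"
    using inj by (simp add: sum.reindex)
  also have "\<dots> \<le> (\<Sum>w\<in>T -` {y}. \<theta> w)"
    using p(1) nonneg by (intro sum_mono2 finite_fibre) auto
  finally show ?thesis .
qed

text \<open>Lifting the target back along the orbit of \<open>w\<close> only decreases the distance,
  so it never leaves the domain of the inverse branches.\<close>
lemma backward_orbit:
  assumes "dist ((T ^^ n) w) x < xi"
  shows "\<exists>z. (T ^^ n) z = x \<and> dist z w \<le> dist ((T ^^ n) w) x"
  using assms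
proof (induction n arbitrary: w)
  case 0
  then show ?case by (auto simp: dist_commute)
next
  case (Suc n)
  then have d: "dist ((T ^^ n) (T w)) x < xi" by (simp add: funpow_swap1)
  then obtain z where z: "(T ^^ n) z = x" "dist z (T w) \<le> dist ((T ^^ n) (T w)) x"
    using Suc.IH by blast
  then have "dist (T w) z < xi" using d by (simp add: dist_commute)
  then obtain v where v: "T v = z" "dist w v \<le> dist (T w) z / lam"
    using contracting_lift by blast
  have "dist (T w) z / lam \<le> dist (T w) z"
    using lam mult_left_mono[of 1 lam "dist (T w) z"] by (simp add: field_simps)
  then show ?case
    using v z by (intro exI[of _ v]) (auto simp: funpow_swap1 dist_commute)
qed

text \<open>Transitivity joins any two balls of a finite cover, so only finitely many times occur;
  lifting along the joining orbit reaches the given end point exactly.\<close>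
lemma preimages_uniformly_dense:
  "\<exists>n0. \<forall>x y. \<exists>n\<le>n0. \<exists>z. (T ^^ n) z = x \<and> dist z y < xi"
proof -
  obtain C :: "'a set" where C: "finite C" "\<And>x. \<exists>c\<in>C. dist x c < xi / 4"
    using finite_net[OF compact_space, of "xi / 4"] xi by auto
  have "\<exists>n w. dist c w < xi / 4 \<and> dist d ((T ^^ n) w) < xi / 4" for c d
  proof -
    have "\<exists>n. (T ^^ n) ` ball c (xi / 4) \<inter> ball d (xi / 4) \<noteq> {}"
      using trans xi unfolding topologically_transitive_def by auto
    then show ?thesis by auto
  qed
  then obtain k w where kw: "\<And>c d. dist c (w c d) < xi / 4"
    "\<And>c d. dist d ((T ^^ k c d) (w c d)) < xi / 4"
    by metis
  define n0 where "n0 = Max ((\<lambda>(c, d). k c d) ` (C \<times> C))"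
  have "\<exists>n\<le>n0. \<exists>z. (T ^^ n) z = x \<and> dist z y < xi" for x y
  proof -
    obtain c d where cd: "c \<in> C" "d \<in> C" "dist y c < xi / 4" "dist x d < xi / 4"
      using C(2) by blast
    have dx: "dist ((T ^^ k c d) (w c d)) x < xi / 2"
      using kw(2)[where c = c and d = d] cd(4) dist_triangle[of "(T ^^ k c d) (w c d)" x d]
      by (simp add: dist_commute)
    then obtain z where z: "(T ^^ k c d) z = x" "dist z (w c d) \<le> dist ((T ^^ k c d) (w c d)) x"
      using backward_orbit[of "k c d" "w c d" x] xi by auto
    have "dist z y \<le> dist z (w c d) + (dist (w c d) c + dist c y)"
      using dist_triangle[of z y "w c d"] dist_triangle[of "w c d" y c] by linarith
    then have "dist z y < xi"
      using z(2) dx kw(1)[where c = c and d = d] cd(3) by (simp add: dist_commute)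
    moreover have "k c d \<le> n0"
      unfolding n0_def using cd C(1) by (intro Max_ge) auto
    ultimately show ?thesis using z(1) by blast
  qed
  then show ?thesis by blast
qed

lemma continuous_on_fibre_Max:
  fixes f :: "'a \<Rightarrow> real"
  assumes f: "continuous_on UNIV f"
  shows "continuous_on UNIV (\<lambda>x. Max (f ` (T -` {x})))"
  unfolding continuous_on_iff
proof (intro ballI allI impI)
  fix x e assume "e > (0 :: real)"
  then have "e / 2 > 0" by simp
  then obtain d where d: "d > 0" "\<And>x y. dist x y < d \<Longrightarrow> \<bar>f x - f y\<bar> < e / 2"
    using compact_UNIV_uniformly_continuous[OF compact_space f] by blast
  have half: "Max (f ` (T -` {x})) \<le> Max (f ` (T -` {y})) + e / 2" if xy: "dist x y < min xi d" for x y
  proof -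
    have "f z \<le> Max (f ` (T -` {y})) + e / 2" if z: "T z = x" for z
    proof -
      obtain w where w: "T w = y" "dist z w \<le> dist x y / lam"
        using contracting_lift[of z y] xy z by auto
      have "dist x y / lam \<le> dist x y"
        using lam mult_left_mono[of 1 lam "dist x y"] by (simp add: field_simps)
      then have "\<bar>f z - f w\<bar> < e / 2" using d(2)[of z w] w xy by auto
      moreover have "f w \<le> Max (f ` (T -` {y}))"
        using finite_fibre w(1) by (intro Max_ge) auto
      ultimately show ?thesis by linarith
    qed
    then show ?thesis using finite_fibre fibre_nonempty by (auto simp: Max_le_iff)
  qed
  show "\<exists>d>0. \<forall>y\<in>UNIV. dist y x < d \<longrightarrow> dist (Max (f ` (T -` {y}))) (Max (f ` (T -` {x}))) < e"
  proof (intro exI[of _ "min xi d"] conjI ballI impI)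
    fix y assume "dist y x < min xi d"
    then show "dist (Max (f ` (T -` {y}))) (Max (f ` (T -` {x}))) < e"
      using half[of x y] half[of y x] \<open>e > 0\<close> by (simp add: dist_real_def dist_commute abs_if)
  qed (use xi d in auto)
qed

end

section \<open>Ruelle eigenfunctions and eigenmeasures at one potential\<close>

text \<open>The bound \<open>N\<close> is a parameter so that one value of it serves the potentials
  at all temperatures.\<close>
locale ruelle_eigendata = expanding_system T lam eta xi
  for T :: "'a::metric_space \<Rightarrow> 'a" and lam eta xi +
  fixes \<phi> u :: "'a \<Rightarrow> real" and m :: "'a measure" and N :: nat
  assumes phi_cont: "continuous_on UNIV \<phi>"
    and eigenmeasure: "eigenmeasure T \<phi> m"
    and eigenfunction: "eigenfunction T \<phi> m u"
    and card_fibre: "\<And>x. card (T -` {x}) \<le> N"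
begin

abbreviation "P \<equiv> pressure T \<phi>"
abbreviation "g \<equiv> normalized_potential T \<phi> u"
abbreviation "\<mu> \<equiv> equilibrium_state m u"

lemma u_cont: "continuous_on UNIV u" and u_pos: "u x > 0"
  and u_eigen: "(\<Sum>y\<in>T -` {x}. u y * exp (\<phi> y)) = exp P * u x"
  and u_integral: "(\<integral>x. u x \<partial>m) = 1"
  and m_prob: "borel_prob m"
  using eigenfunction eigenmeasure unfolding eigenfunction_def eigenmeasure_def ruelle_def by auto

lemma ln_u_cont: "continuous_on UNIV (\<lambda>x. ln (u x))"
  using u_pos by (intro continuous_on_ln u_cont) (simp add: less_imp_neq[symmetric])

lemma ln_u_T_cont: "continuous_on UNIV (\<lambda>x. ln (u (T x)))"
  using continuous_on_compose2[OF ln_u_cont cont] by simp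

lemma g_cont: "continuous_on UNIV g"
  unfolding normalized_potential_def[abs_def]
  by (intro continuous_intros phi_cont ln_u_cont ln_u_T_cont)

lemma exp_g: "exp (g y) = u y * exp (\<phi> y) / (exp P * u (T y))"
  using u_pos[of y] u_pos[of "T y"]
  by (simp add: normalized_potential_def exp_add exp_diff field_simps)

lemma sum_exp_g: "(\<Sum>y\<in>T -` {x}. exp (g y)) = 1"
proof -
  have "(\<Sum>y\<in>T -` {x}. exp (g y)) = (\<Sum>y\<in>T -` {x}. u y * exp (\<phi> y)) / (exp P * u x)"
    unfolding sum_divide_distrib by (intro sum.cong) (auto simp: exp_g)
  then show ?thesis using u_pos[of x] by (simp add: u_eigen)
qed

lemma g_nonpos: "g y \<le> 0"
proof -
  have "exp (g y) \<le> (\<Sum>z\<in>T -` {T y}. exp (g z))"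
    using finite_fibre by (intro member_le_sum) auto
  then show ?thesis by (simp add: sum_exp_g)
qed

text \<open>A modulus of continuity valid at scale \<open>r\<close> extends to scale \<open>lam *
  r\<close>: compare the two sides of the eigenvalue equation at \<open>x\<close> and
  \<open>y\<close>, where the paired preimages are \<open>lam\<close> times closer. The constant
  \<open>K\<close> solves \<open>(K + C) / lam powr \<alpha> = K\<close>, so that adding one
  increment of \<open>\<phi>\<close> reproduces the same modulus.\<close>
lemma ln_u_local_step:
  assumes C: "\<And>x y. \<bar>\<phi> x - \<phi> y\<bar> \<le> C * dist x y powr \<alpha>" "C \<ge> 0" "\<alpha> > 0"
    and K: "K = C / (lam powr \<alpha> - 1)"
    and r: "\<And>x y. dist x y < r \<Longrightarrow> ln (u x) - ln (u y) \<le> K * dist x y powr \<alpha> + e"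
    and xy: "dist x y < xi" "dist x y < lam * r"
  shows "ln (u x) - ln (u y) \<le> K * dist x y powr \<alpha> + e"
proof -
  define b where "b = K * dist x y powr \<alpha> + e"
  have lama: "lam powr \<alpha> > 1" using lam C(3) by (simp add: gr_one_powr)
  then have K0: "K \<ge> 0" using K C(2) by simp
  have KC: "K + C = K * lam powr \<alpha>" using K lama by (simp add: field_simps)
  have "(\<Sum>z\<in>T -` {x}. u z * exp (\<phi> z)) \<le> (\<Sum>w\<in>T -` {y}. exp b * (u w * exp (\<phi> w)))"
  proof (rule fibre_sum_le[OF xy(1)])
    fix z w assume zw: "T z = x" "T w = y" "dist z w \<le> dist x y / lam"
    have "dist x y / lam < r" using xy(2) lam by (simp add: field_simps)
    then have zr: "dist z w < r" using zw(3) by simp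
    have "dist z w powr \<alpha> \<le> (dist x y / lam) powr \<alpha>"
      using zw(3) C(3) by (intro powr_mono2) auto
    also have "\<dots> = dist x y powr \<alpha> / lam powr \<alpha>"
      using lam by (simp add: powr_divide)
    finally have "(K + C) * dist z w powr \<alpha> \<le> (K + C) * (dist x y powr \<alpha> / lam powr \<alpha>)"
      using K0 C(2) by (intro mult_left_mono) auto
    also have "\<dots> = K * dist x y powr \<alpha>"
      using lam by (simp add: KC)
    finally have "K * dist z w powr \<alpha> + C * dist z w powr \<alpha> \<le> K * dist x y powr \<alpha>"
      by (simp add: distrib_right)
    then have "ln (u z) + \<phi> z \<le> b + (ln (u w) + \<phi> w)"
      using r[OF zr] C(1)[of z w] by (simp add: b_def)
    then have "exp (ln (u z) + \<phi> z) \<le> exp (b + (ln (u w) + \<phi> w))" by simp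
    then show "u z * exp (\<phi> z) \<le> exp b * (u w * exp (\<phi> w))"
      using u_pos[of z] u_pos[of w] by (simp add: exp_add)
  next
    fix w show "0 \<le> exp b * (u w * exp (\<phi> w))" using u_pos[of w] by simp
  qed
  also have "\<dots> = exp b * (exp P * u y)"
    by (simp add: sum_distrib_left[symmetric] u_eigen)
  finally have "u x \<le> exp b * u y" by (simp add: u_eigen)
  then have "ln (u x) \<le> ln (exp b * u y)" using u_pos[of x] u_pos[of y] by (subst ln_le_cancel_iff) auto
  then show ?thesis using u_pos[of y] by (simp add: ln_mult b_def)
qed

text \<open>Uniform continuity gives the modulus at some small scale up to an error
  \<open>e\<close>, and repeated expansion carries it to scale \<open>xi\<close> with the same
  error. The bound is linear in \<open>C\<close> and refers to no other property of
  \<open>u\<close>, which makes it uniform after division by \<open>\<beta>\<close>.\<close>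
lemma ln_u_local:
  assumes C: "\<And>x y. \<bar>\<phi> x - \<phi> y\<bar> \<le> C * dist x y powr \<alpha>" "C \<ge> 0" "\<alpha> > 0"
    and xy: "dist x y < xi"
  shows "ln (u x) - ln (u y) \<le> C / (lam powr \<alpha> - 1) * dist x y powr \<alpha>"
proof (rule field_le_epsilon)
  fix e :: real assume "e > 0"
  define K where "K = C / (lam powr \<alpha> - 1)"
  have "lam powr \<alpha> > 1" using lam C(3) by (simp add: gr_one_powr)
  then have K0: "K \<ge> 0" using C(2) by (simp add: K_def)
  obtain r where r: "r > 0" "\<And>x y. dist x y < r \<Longrightarrow> \<bar>ln (u x) - ln (u y)\<bar> < e"
    using compact_UNIV_uniformly_continuous[OF compact_space ln_u_cont \<open>e > 0\<close>] by blast
  \<comment> \<open>The scale is capped at \<open>xi\<close>, beyond which fibres can no longer be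
    paired.\<close>
  have iter: "\<And>x y. dist x y < min xi (lam ^ n * r) \<Longrightarrow>
      ln (u x) - ln (u y) \<le> K * dist x y powr \<alpha> + e" for n
  proof (induction n)
    case 0
    have "0 \<le> K * dist x y powr \<alpha>" using K0 by simp
    then show ?case using r(2)[of x y] 0 by simp
  next
    case (Suc n)
    have "xi < lam * xi" using lam xi by simp
    then have "dist x y < lam * min xi (lam ^ n * r)"
      using Suc.prems lam by (simp add: min_def mult.assoc split: if_splits)
    then show ?case
      using Suc.prems by (intro ln_u_local_step[OF C K_def Suc.IH]) auto
  qed
  obtain n where "xi / r < lam ^ n" using real_arch_pow[OF lam] by blast
  then have "xi < lam ^ n * r" using r(1) by (simp add: field_simps)
  then show "ln (u x) - ln (u y) \<le> C / (lam powr \<alpha> - 1) * dist x y powr \<alpha> + e"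
    using iter[of x y n] xy by (simp add: K_def)
qed

text \<open>Along an orbit \<open>ln u\<close> drops by at most \<open>D\<close> per step, because
  \<open>g \<le> 0\<close>.\<close>
lemma ln_u_funpow:
  assumes "\<And>z. P - \<phi> z \<le> D"
  shows "ln (u z) - real n * D \<le> ln (u ((T ^^ n) z))"
proof (induction n)
  case (Suc n)
  have "ln (u ((T ^^ n) z)) - D \<le> ln (u (T ((T ^^ n) z)))"
    using g_nonpos[of "(T ^^ n) z"] assms[of "(T ^^ n) z"] by (simp add: normalized_potential_def)
  then show ?case using Suc by (simp add: algebra_simps)
qed simp

text \<open>Some point near \<open>y\<close> reaches \<open>x\<close> within \<open>n0\<close>
  steps: the local bound compares \<open>y\<close> with that point, and the bound along its orbit
  compares the latter with \<open>x\<close>.\<close>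
lemma ln_u_oscillation:
  assumes n0: "\<And>x y. \<exists>n\<le>n0. \<exists>z. (T ^^ n) z = x \<and> dist z y < xi"
    and D: "\<And>z. P - \<phi> z \<le> D" "D \<ge> 0"
    and K: "\<And>x y. dist x y < xi \<Longrightarrow> ln (u x) - ln (u y) \<le> K"
  shows "ln (u y) - ln (u x) \<le> K + real n0 * D"
proof -
  obtain n z where z: "n \<le> n0" "(T ^^ n) z = x" "dist z y < xi" using n0 by blast
  have "real n * D \<le> real n0 * D" using z(1) D(2) by (intro mult_right_mono) auto
  then show ?thesis
    using ln_u_funpow[OF D(1), of z n] K[of y z] z by (simp add: dist_commute)
qed

lemma integral_equilibrium:
  assumes "continuous_on UNIV f"
  shows "(\<integral>x. f x \<partial>\<mu>) = (\<integral>x. u x * f x \<partial>m)"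
  unfolding equilibrium_state_def using u_pos
  by (subst integral_density)
    (auto intro!: borel_prob_measurable[OF m_prob] assms u_cont less_imp_le)

lemma mu_prob: "borel_prob \<mu>"
proof -
  have "emeasure \<mu> (space \<mu>) = (\<integral>\<^sup>+x. ennreal (u x) \<partial>m)"
    unfolding equilibrium_state_def using borel_prob_measurable[OF m_prob u_cont]
    by (subst emeasure_density) (auto intro!: nn_integral_cong)
  also have "\<dots> = ennreal (\<integral>x. u x \<partial>m)"
    using u_pos
    by (intro nn_integral_eq_integral borel_prob_integrable[OF compact_space m_prob u_cont])
      (auto intro: less_imp_le)
  finally have "prob_space \<mu>" by (intro prob_spaceI) (simp add: u_integral)
  then show ?thesis
    using borel_probD[OF m_prob] by (simp add: borel_prob_def equilibrium_state_def)
qed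

text \<open>Invariance of \<open>\<mu>\<close> under the dual of the normalised operator. The
  left-hand side is an integral over \<open>m\<close> because its integrand is a constant multiple
  of the Ruelle operator applied to \<open>u * f\<close>, where the eigenmeasure identity applies
  directly.\<close>
lemma integral_transfer:
  assumes "continuous_on UNIV f"
  shows "(\<integral>x. u x * (\<Sum>y\<in>T -` {x}. exp (g y) * f y) \<partial>m) = (\<integral>x. f x \<partial>\<mu>)"
proof -
  have "u x * (\<Sum>y\<in>T -` {x}. exp (g y) * f y) = ruelle T \<phi> (\<lambda>y. u y * f y) x / exp P" for x
    unfolding ruelle_def sum_divide_distrib sum_distrib_left
    using u_pos[of x] by (intro sum.cong) (auto simp: exp_g field_simps)
  then have "(\<integral>x. u x * (\<Sum>y\<in>T -` {x}. exp (g y) * f y) \<partial>m)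
      = (\<integral>x. ruelle T \<phi> (\<lambda>y. u y * f y) x \<partial>m) / exp P" by simp
  also have "\<dots> = (\<integral>x. u x * f x \<partial>m)"
    using eigenmeasure u_cont assms unfolding eigenmeasure_def
    by (simp add: continuous_on_mult)
  finally show ?thesis by (simp add: integral_equilibrium[OF assms])
qed

lemma integral_le_if_transfer_le:
  assumes f: "continuous_on UNIV f" and h: "continuous_on UNIV h"
    and le: "\<And>x. (\<Sum>y\<in>T -` {x}. exp (g y) * f y) \<le> h x" and nonneg: "\<And>x. 0 \<le> h x"
  shows "(\<integral>x. f x \<partial>\<mu>) \<le> (\<integral>x. h x \<partial>\<mu>)"
  unfolding integral_transfer[OF f, symmetric] integral_equilibrium[OF h]
proof (rule integral_mono')
  show "integrable m (\<lambda>x. u x * h x)"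
    by (intro borel_prob_integrable[OF compact_space m_prob] continuous_intros u_cont h)
qed (use le nonneg u_pos[THEN less_imp_le] in \<open>auto intro: mult_left_mono\<close>)

text \<open>A nonzero integral can only come from an integrable function, which supplies the
  integrability of the fibre sum.\<close>
lemma integral_ge_if_transfer_ge:
  assumes f: "continuous_on UNIV f" and h: "continuous_on UNIV h"
    and le: "\<And>x. h x \<le> (\<Sum>y\<in>T -` {x}. exp (g y) * f y)" and "(\<integral>x. f x \<partial>\<mu>) \<noteq> 0"
  shows "(\<integral>x. h x \<partial>\<mu>) \<le> (\<integral>x. f x \<partial>\<mu>)"
proof -
  have "integrable m (\<lambda>x. u x * (\<Sum>y\<in>T -` {x}. exp (g y) * f y))"
    using assms(4) not_integrable_integral_eq unfolding integral_transfer[OF f, symmetric] by blast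
  moreover have "integrable m (\<lambda>x. u x * h x)"
    by (intro borel_prob_integrable[OF compact_space m_prob] continuous_intros u_cont h)
  ultimately show ?thesis
    unfolding integral_transfer[OF f, symmetric] integral_equilibrium[OF h]
    using le u_pos by (intro integral_mono) (auto intro!: mult_left_mono less_imp_le)
qed

text \<open>The fibre average of \<open>f \<circ> T\<close> is \<open>f\<close>, because the weights
  sum to 1.\<close>
lemma mu_invariant: "distr \<mu> borel T = \<mu>"
proof (rule borel_prob_eqI)
  interpret prob_space \<mu> by (rule borel_probD(1)[OF mu_prob])
  have meas: "T \<in> \<mu> \<rightarrow>\<^sub>M borel" by (rule borel_prob_measurable[OF mu_prob cont])
  show "borel_prob (distr \<mu> borel T)"
    using prob_space_distr[OF meas] by (simp add: borel_prob_def)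
  show "borel_prob \<mu>" by (rule mu_prob)
  fix f :: "'a \<Rightarrow> real" assume f: "continuous_on UNIV f"
  have fT: "continuous_on UNIV (\<lambda>x. f (T x))" using continuous_on_compose2[OF f cont] by simp
  have "(\<Sum>y\<in>T -` {x}. exp (g y) * f (T y)) = f x" for x
  proof -
    have "(\<Sum>y\<in>T -` {x}. exp (g y) * f (T y)) = (\<Sum>y\<in>T -` {x}. exp (g y)) * f x"
      unfolding sum_distrib_right by (intro sum.cong) auto
    then show ?thesis by (simp add: sum_exp_g)
  qed
  then have "(\<integral>x. f (T x) \<partial>\<mu>) = (\<integral>x. u x * f x \<partial>m)"
    using integral_transfer[OF fT] by simp
  then show "(\<integral>x. f x \<partial>distr \<mu> borel T) = (\<integral>x. f x \<partial>\<mu>)"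
    using integral_distr[OF meas borel_measurable_continuous_onI[OF f]]
    by (simp add: integral_equilibrium[OF f])
qed

text \<open>The coboundary \<open>ln u - ln u \<circ> T\<close> integrates to 0.\<close>
lemma integral_g_invariant:
  assumes \<nu>: "borel_prob \<nu>" "distr \<nu> borel T = \<nu>"
  shows "(\<integral>x. g x \<partial>\<nu>) = (\<integral>x. \<phi> x \<partial>\<nu>) - P"
proof -
  interpret prob_space \<nu> by (rule borel_probD(1)[OF \<nu>(1)])
  note int = borel_prob_integrable[OF compact_space \<nu>(1)]
  have meas: "T \<in> \<nu> \<rightarrow>\<^sub>M borel" by (rule borel_prob_measurable[OF \<nu>(1) cont])
  have "(\<integral>x. ln (u x) \<partial>\<nu>) = (\<integral>x. ln (u x) \<partial>distr \<nu> borel T)" by (simp add: \<nu>(2))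
  also have "\<dots> = (\<integral>x. ln (u (T x)) \<partial>\<nu>)"
    by (intro integral_distr meas borel_measurable_continuous_onI ln_u_cont)
  finally show ?thesis
    unfolding normalized_potential_def
    using int[OF phi_cont] int[OF ln_u_cont] int[OF ln_u_T_cont] prob_space
    by simp
qed

lemma integral_le_pressure:
  assumes "borel_prob \<nu>" "distr \<nu> borel T = \<nu>"
  shows "(\<integral>x. \<phi> x \<partial>\<nu>) \<le> P"
proof -
  have "(\<integral>x. - g x \<partial>\<nu>) \<ge> 0" using g_nonpos by (intro integral_nonneg_AE AE_I2) simp
  then show ?thesis by (simp add: integral_g_invariant[OF assms])
qed

text \<open>The integral of \<open>- g\<close> is the entropy of \<open>\<mu>\<close>. The crude
  bound \<open>N\<close> comes from \<open>- t * exp t \<le> 1\<close> applied to each of the at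
  most \<open>N\<close> weights of a fibre.\<close>
lemma pressure_le_integral: "P \<le> (\<integral>x. \<phi> x \<partial>\<mu>) + real N"
proof -
  interpret mu: prob_space \<mu> by (rule borel_probD(1)[OF mu_prob])
  have "(\<integral>x. - g x \<partial>\<mu>) \<le> (\<integral>x. real N \<partial>\<mu>)"
  proof (rule integral_le_if_transfer_le)
    fix x
    have "exp t * - t \<le> 1" for t :: real
    proof -
      have "- t \<le> exp (- t)" using exp_ge_add_one_self[of "- t"] by linarith
      then have "exp t * - t \<le> exp t * exp (- t)" by (intro mult_left_mono) auto
      then show ?thesis by (simp add: exp_minus)
    qed
    then have "(\<Sum>y\<in>T -` {x}. exp (g y) * - g y) \<le> (\<Sum>y\<in>T -` {x}. 1)"
      by (intro sum_mono) auto
    also have "\<dots> \<le> real N" using card_fibre[of x] by simp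
    finally show "(\<Sum>y\<in>T -` {x}. exp (g y) * - g y) \<le> real N" .
  qed (use g_cont in \<open>auto intro: continuous_on_minus\<close>)
  then show ?thesis
    using mu.prob_space by (simp add: integral_g_invariant[OF mu_prob mu_invariant])
qed

end

context ruelle_eigendata
begin

text \<open>The lower bound for the pressure holds for every invariant measure, and the upper bound
  tests the supremum with the equilibrium state.\<close>
lemma pressure_near_max_average:
  assumes A: "continuous_on UNIV A" and \<beta>: "\<beta> > 0" and \<phi>: "\<phi> = (\<lambda>x. \<beta> * A x)"
  shows "\<beta> * max_ergodic_average T A \<le> P" "P \<le> \<beta> * max_ergodic_average T A + real N"
proof -
  let ?S = "{\<nu>. borel_prob \<nu> \<and> distr \<nu> borel T = \<nu>}"
  have "(\<integral>x. A x \<partial>\<nu>) \<le> P / \<beta>" if "\<nu> \<in> ?S" for \<nu>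
    using integral_le_pressure[of \<nu>] that \<beta> by (simp add: \<phi> field_simps)
  moreover have mu: "\<mu> \<in> ?S" using mu_prob mu_invariant by simp
  ultimately have "max_ergodic_average T A \<le> P / \<beta>"
    and bdd: "bdd_above ((\<lambda>\<nu>. \<integral>x. A x \<partial>\<nu>) ` ?S)"
    unfolding max_ergodic_average_def by (auto intro!: cSUP_least bdd_aboveI2)
  then show "\<beta> * max_ergodic_average T A \<le> P" using \<beta> by (simp add: field_simps)
  have "(\<integral>x. A x \<partial>\<mu>) \<le> max_ergodic_average T A"
    unfolding max_ergodic_average_def by (rule cSUP_upper[OF mu bdd])
  then have "\<beta> * (\<integral>x. A x \<partial>\<mu>) \<le> \<beta> * max_ergodic_average T A"
    using \<beta> by simp
  then show "P \<le> \<beta> * max_ergodic_average T A + real N"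
    using pressure_le_integral by (simp add: \<phi>)
qed

lemma N_pos: "real N \<ge> 1"
proof -
  have "card (T -` {x}) > 0" for x
    using finite_fibre fibre_nonempty by (simp add: card_gt_0_iff)
  then show ?thesis using card_fibre[of undefined] by (metis One_nat_def Suc_leI le_trans of_nat_1 of_nat_le_iff)
qed

text \<open>Replace \<open>g\<close> by \<open>\<beta> * B\<close> at the cost \<open>e\<close>, and
  a fibre sum of at most \<open>N\<close> exponentials by its largest term at the cost \<open>ln N /
  \<beta>\<close>.\<close>
lemma log_laplace_transfer:
  fixes f F :: "'a \<Rightarrow>\<^sub>C real"
  assumes \<beta>: "\<beta> > 0" and close: "\<And>x. \<bar>g x / \<beta> - B x\<bar> \<le> e"
    and F: "\<And>x. F x = Max ((\<lambda>y. f y + B y) ` (T -` {x}))"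
  shows "\<bar>log_laplace \<beta> \<mu> f - log_laplace \<beta> \<mu> F\<bar> \<le> e + ln (real N) / \<beta>"
proof -
  have summand: "exp (g y) * exp (\<beta> * f y) = exp (\<beta> * (g y / \<beta> + f y))" for y
    using \<beta> by (simp add: exp_add[symmetric] distrib_left)
  have upper: "(\<Sum>y\<in>T -` {x}. exp (g y) * exp (\<beta> * f y)) \<le> real N * exp (\<beta> * (F x + e))" for x
  proof -
    have "exp (g y) * exp (\<beta> * f y) \<le> exp (\<beta> * (F x + e))" if y: "y \<in> T -` {x}" for y
    proof -
      have "f y + B y \<le> F x"
        unfolding F using finite_fibre y by (intro Max_ge) auto
      then have "g y / \<beta> + f y \<le> F x + e" using close[of y] by linarith
      then show ?thesis unfolding summand using \<beta> by simp
    qed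
    then have "(\<Sum>y\<in>T -` {x}. exp (g y) * exp (\<beta> * f y)) \<le> real (card (T -` {x})) * exp (\<beta> * (F x + e))"
      by (rule sum_bounded_above)
    also have "\<dots> \<le> real N * exp (\<beta> * (F x + e))"
      using card_fibre[of x] by (intro mult_right_mono) auto
    finally show ?thesis .
  qed
  have lower: "exp (\<beta> * (F x - e)) \<le> (\<Sum>y\<in>T -` {x}. exp (g y) * exp (\<beta> * f y))" for x
  proof -
    have "F x \<in> (\<lambda>y. f y + B y) ` (T -` {x})"
      unfolding F using finite_fibre fibre_nonempty by (intro Max_in) auto
    then obtain y where y: "y \<in> T -` {x}" "F x = f y + B y" by blast
    then have "F x - e \<le> g y / \<beta> + f y" using close[of y] by linarith
    then have "exp (\<beta> * (F x - e)) \<le> exp (g y) * exp (\<beta> * f y)"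
      unfolding summand using \<beta> by simp
    also have "\<dots> \<le> (\<Sum>y\<in>T -` {x}. exp (g y) * exp (\<beta> * f y))"
      using finite_fibre y(1) by (intro member_le_sum) auto
    finally show ?thesis .
  qed
  note le_iff = log_laplace_le_iff[OF compact_space mu_prob \<beta>]
  have "(\<integral>x. exp (\<beta> * f x) \<partial>\<mu>) \<le> (\<integral>x. real N * exp (\<beta> * (F x + e)) \<partial>\<mu>)"
    by (rule integral_le_if_transfer_le[OF _ _ upper]) (auto intro!: continuous_intros)
  also have "\<dots> = exp (\<beta> * (e + ln (real N) / \<beta>)) * (\<integral>x. exp (\<beta> * F x) \<partial>\<mu>)"
    using \<beta> N_pos by (simp add: distrib_left exp_add mult_ac)
  finally have "log_laplace \<beta> \<mu> f \<le> log_laplace \<beta> \<mu> F + (e + ln (real N) / \<beta>)"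
    unfolding le_iff .
  moreover
  have "(\<integral>x. exp (\<beta> * (F x - e)) \<partial>\<mu>) \<le> (\<integral>x. exp (\<beta> * f x) \<partial>\<mu>)"
    using exp_integral_pos[OF compact_space mu_prob, of \<beta> f]
    by (intro integral_ge_if_transfer_ge lower) (auto intro!: continuous_intros)
  then have "log_laplace \<beta> \<mu> F \<le> log_laplace \<beta> \<mu> f + e"
    unfolding le_iff using \<beta> by (simp add: right_diff_distrib exp_diff field_simps)
  moreover have "0 \<le> ln (real N) / \<beta>" using N_pos \<beta> by simp
  ultimately show ?thesis by linarith
qed

end

section \<open>The family of potentials at positive temperature\<close>

text \<open>The Hoelder data of \<open>A\<close> and the constants of \<open>T\<close> are shared by
  all \<open>\<beta>\<close>, which makes the bounds below uniform in
  \<open>\<beta>\<close>.\<close>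
locale ruelle_family = expanding_system T lam eta xi
  for T :: "'a::metric_space \<Rightarrow> 'a" and lam eta xi +
  fixes A :: "'a \<Rightarrow> real" and \<alpha> C :: real
    and u :: "real \<Rightarrow> 'a \<Rightarrow> real" and m :: "real \<Rightarrow> 'a measure" and N :: nat
  assumes holder: "\<And>x y. \<bar>A x - A y\<bar> \<le> C * dist x y powr \<alpha>" and C: "C \<ge> 0" and alpha: "\<alpha> > 0"
    and eigenmeasures: "\<And>\<beta>. \<beta> > 0 \<Longrightarrow> eigenmeasure T (\<lambda>x. \<beta> * A x) (m \<beta>)"
    and eigenfunctions: "\<And>\<beta>. \<beta> > 0 \<Longrightarrow> eigenfunction T (\<lambda>x. \<beta> * A x) (m \<beta>) (u \<beta>)"
    and fibre_card: "\<And>x. card (T -` {x}) \<le> N"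
begin

abbreviation "G \<beta> \<equiv> normalized_potential T (\<lambda>x. \<beta> * A x) (u \<beta>)"
abbreviation "\<Lambda> \<beta> \<equiv> log_laplace \<beta> (equilibrium_state (m \<beta>) (u \<beta>))"
abbreviation "Q \<equiv> max_ergodic_average T A"

lemma holder_modulus:
  assumes "K \<ge> 0" "e > 0"
  shows "\<exists>d>0. \<forall>t\<ge>0. t < d \<longrightarrow> K * t powr \<alpha> < e"
proof (intro exI[of _ "(e / (K + 1)) powr (1 / \<alpha>)"] conjI allI impI)
  have pos: "e / (K + 1) > 0" using assms by simp
  then show "(e / (K + 1)) powr (1 / \<alpha>) > 0" by (metis less_irrefl powr_gt_zero)
  fix t :: real assume t: "0 \<le> t" "t < (e / (K + 1)) powr (1 / \<alpha>)"
  then have "t powr \<alpha> \<le> ((e / (K + 1)) powr (1 / \<alpha>)) powr \<alpha>"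
    using alpha by (intro powr_mono2) auto
  also have "\<dots> = e / (K + 1)" using alpha assms by (simp add: powr_powr)
  finally have "(K + 1) * t powr \<alpha> \<le> e" using assms by (simp add: field_simps)
  then show "K * t powr \<alpha> < e"
  proof (cases "t = 0")
    case False
    then have "0 < t powr \<alpha>" by simp
    moreover have "(K + 1) * t powr \<alpha> = K * t powr \<alpha> + t powr \<alpha>" by (simp add: distrib_right)
    ultimately show ?thesis using \<open>(K + 1) * t powr \<alpha> \<le> e\<close> by linarith
  qed (use assms in simp)
qed

lemma A_cont: "continuous_on UNIV A"
  unfolding continuous_on_iff
proof (intro ballI allI impI)
  fix x and e :: real assume "e > 0"
  then obtain d where "d > 0" "\<And>t. t \<ge> 0 \<Longrightarrow> t < d \<Longrightarrow> C * t powr \<alpha> < e"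
    using holder_modulus[OF C] by blast
  then show "\<exists>d>0. \<forall>y\<in>UNIV. dist y x < d \<longrightarrow> dist (A y) (A x) < e"
    using holder unfolding dist_real_def by (meson le_less_trans zero_le_dist)
qed

lemma eigendata:
  assumes "\<beta> > 0"
  shows "ruelle_eigendata T lam eta xi (\<lambda>x. \<beta> * A x) (u \<beta>) (m \<beta>) N"
  using eigenmeasures[OF assms] eigenfunctions[OF assms] fibre_card
  by unfold_locales (auto intro!: continuous_intros A_cont)

lemma pressure_average:
  assumes "\<beta> > 0"
  shows "Q \<le> pressure T (\<lambda>x. \<beta> * A x) / \<beta>"
    "pressure T (\<lambda>x. \<beta> * A x) / \<beta> \<le> Q + real N / \<beta>"
proof -
  interpret E: ruelle_eigendata T lam eta xi "\<lambda>x. \<beta> * A x" "u \<beta>" "m \<beta>" N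
    by (rule eigendata[OF assms])
  show "Q \<le> pressure T (\<lambda>x. \<beta> * A x) / \<beta>"
    "pressure T (\<lambda>x. \<beta> * A x) / \<beta> \<le> Q + real N / \<beta>"
    using E.pressure_near_max_average[OF A_cont assms refl] assms by (auto simp: field_simps)
qed

lemma scaled_potential:
  assumes "\<beta> > 0"
  shows "G \<beta> x / \<beta> = A x + ln (u \<beta> x) / \<beta> - ln (u \<beta> (T x)) / \<beta> - pressure T (\<lambda>x. \<beta> * A x) / \<beta>"
  using assms by (simp add: normalized_potential_def diff_divide_distrib add_divide_distrib)

lemma log_eigenfunction_local:
  assumes \<beta>: "\<beta> > 0" and xy: "dist x y < xi"
  shows "\<bar>ln (u \<beta> x) / \<beta> - ln (u \<beta> y) / \<beta>\<bar> \<le> C / (lam powr \<alpha> - 1) * dist x y powr \<alpha>"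
proof -
  interpret E: ruelle_eigendata T lam eta xi "\<lambda>x. \<beta> * A x" "u \<beta>" "m \<beta>" N
    by (rule eigendata[OF \<beta>])
  define R where "R = C / (lam powr \<alpha> - 1) * dist x y powr \<alpha>"
  have "\<bar>\<beta> * A x - \<beta> * A y\<bar> \<le> (\<beta> * C) * dist x y powr \<alpha>" for x y
    using mult_left_mono[OF holder[of x y], of \<beta>] \<beta>
    by (simp add: abs_mult right_diff_distrib[symmetric] mult.assoc)
  then have "ln (u \<beta> x) - ln (u \<beta> y) \<le> \<beta> * C / (lam powr \<alpha> - 1) * dist x y powr \<alpha>"
    if "dist x y < xi" for x y
    using C \<beta> alpha that by (intro E.ln_u_local) auto
  from this[of x y] this[of y x] have "\<bar>ln (u \<beta> x) - ln (u \<beta> y)\<bar> \<le> \<beta> * R"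
    using xy by (simp add: dist_commute R_def abs_le_iff)
  then have "\<bar>ln (u \<beta> x) - ln (u \<beta> y)\<bar> / \<beta> \<le> R"
    using \<beta> by (simp add: field_simps)
  moreover have "\<bar>ln (u \<beta> x) / \<beta> - ln (u \<beta> y) / \<beta>\<bar> = \<bar>ln (u \<beta> x) - ln (u \<beta> y)\<bar> / \<beta>"
    using \<beta> by (simp add: diff_divide_distrib[symmetric])
  ultimately show ?thesis by (simp only: R_def)
qed

text \<open>Both terms of \<open>ln_u_oscillation\<close> are at most linear in
  \<open>\<beta>\<close>: the local bound by homogeneity, and the cost per step because the pressure
  differs from \<open>\<beta> * Q\<close> by at most \<open>N\<close>.\<close>
lemma log_eigenfunction_oscillation:
  "\<exists>K. \<forall>\<beta>>1. \<forall>x y. ln (u \<beta> y) / \<beta> - ln (u \<beta> x) / \<beta> \<le> K"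
proof -
  obtain n0 where n0: "\<And>x y. \<exists>n\<le>n0. \<exists>z. (T ^^ n) z = x \<and> dist z y < xi"
    using preimages_uniformly_dense by blast
  obtain B where B: "\<And>x. \<bar>A x\<bar> \<le> B"
    using compact_imp_bounded[OF compact_continuous_image[OF A_cont compact_space]]
    by (auto simp: bounded_iff)
  define K where "K = C / (lam powr \<alpha> - 1) * xi powr \<alpha>"
  define D where "D = \<bar>Q\<bar> + real N + B"
  have "lam powr \<alpha> > 1" using lam alpha by (simp add: gr_one_powr)
  then have coeff: "C / (lam powr \<alpha> - 1) \<ge> 0" using C by simp
  have "D \<ge> 0" using B[of undefined] by (simp add: D_def)
  have "ln (u \<beta> y) / \<beta> - ln (u \<beta> x) / \<beta> \<le> K + real n0 * D" if b: "\<beta> > 1" for \<beta> x y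
  proof -
    interpret E: ruelle_eigendata T lam eta xi "\<lambda>x. \<beta> * A x" "u \<beta>" "m \<beta>" N
      by (rule eigendata) (use b in simp)
    have \<beta>: "\<beta> > 0" using b by simp
    have "ln (u \<beta> y) - ln (u \<beta> x) \<le> \<beta> * K + real n0 * (\<beta> * D)"
    proof (rule E.ln_u_oscillation[OF n0])
      fix z
      have "E.P / \<beta> \<le> Q + real N / \<beta>" using pressure_average[OF \<beta>] by simp
      moreover have "real N / \<beta> \<le> real N / 1" using b by (intro divide_left_mono) auto
      ultimately have "E.P / \<beta> - A z \<le> D" using B[of z] unfolding D_def by linarith
      then have "\<beta> * (E.P / \<beta> - A z) \<le> \<beta> * D" using \<beta> by (intro mult_left_mono) auto
      then show "E.P - \<beta> * A z \<le> \<beta> * D" using \<beta> by (simp add: right_diff_distrib)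
      show "0 \<le> \<beta> * D" using \<beta> \<open>D \<ge> 0\<close> by simp
      fix x y :: 'a assume xy: "dist x y < xi"
      have "dist x y powr \<alpha> \<le> xi powr \<alpha>" using xy alpha by (intro powr_mono2) auto
      then have "C / (lam powr \<alpha> - 1) * dist x y powr \<alpha> \<le> K"
        unfolding K_def using coeff by (rule mult_left_mono)
      then have "ln (u \<beta> x) / \<beta> - ln (u \<beta> y) / \<beta> \<le> K"
        using log_eigenfunction_local[OF \<beta> xy] by linarith
      then show "ln (u \<beta> x) - ln (u \<beta> y) \<le> \<beta> * K"
        using \<beta> by (simp add: diff_divide_distrib[symmetric] field_simps)
    qed
    then show ?thesis
      using \<beta> by (simp add: diff_divide_distrib[symmetric] field_simps)
  qed
  then show ?thesis by blast
qed

lemma normal_family_potentials: "normal_family ((\<lambda>\<beta> x. G \<beta> x / \<beta>) ` {1<..})"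
proof -
  obtain D :: "'a set" where D: "countable D" "closure D = UNIV"
    using compact_countable_dense[OF compact_space] by blast
  obtain K where K: "\<And>\<beta> x y. \<beta> > 1 \<Longrightarrow> ln (u \<beta> y) / \<beta> - ln (u \<beta> x) / \<beta> \<le> K"
    using log_eigenfunction_oscillation by blast
  show ?thesis
  proof (rule normal_family_if_equicontinuous[OF D])
    fix x
    have "\<bar>G \<beta> x / \<beta>\<bar> \<le> \<bar>A x\<bar> + K + \<bar>Q\<bar> + real N" if b: "\<beta> > 1" for \<beta>
    proof -
      have \<beta>: "\<beta> > 0" using b by simp
      have "real N / \<beta> \<le> real N / 1" using b by (intro divide_left_mono) auto
      then have "\<bar>pressure T (\<lambda>x. \<beta> * A x) / \<beta>\<bar> \<le> \<bar>Q\<bar> + real N"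
        using pressure_average[OF \<beta>] by linarith
      moreover have "\<bar>ln (u \<beta> x) / \<beta> - ln (u \<beta> (T x)) / \<beta>\<bar> \<le> K"
        using K[OF b, of x "T x"] K[OF b, of "T x" x] by linarith
      ultimately show ?thesis unfolding scaled_potential[OF \<beta>] by linarith
    qed
    then show "\<exists>M. \<forall>f\<in>(\<lambda>\<beta> x. G \<beta> x / \<beta>) ` {1<..}. \<bar>f x\<bar> \<le> M" by auto
  next
    fix x and e :: real assume e: "e > 0"
    define L where "L = C / (lam powr \<alpha> - 1)"
    have "lam powr \<alpha> > 1" using lam alpha by (simp add: gr_one_powr)
    then have L: "L \<ge> 0" using C by (simp add: L_def)
    obtain d where d: "d > 0" "\<And>t. t \<ge> 0 \<Longrightarrow> t < d \<Longrightarrow> L * t powr \<alpha> < e / 3"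
      using holder_modulus[OF L, of "e / 3"] e by auto
    have near: "\<bar>ln (u \<beta> y) / \<beta> - ln (u \<beta> z) / \<beta>\<bar> < e / 3"
      if "\<beta> > 1" "dist y z < xi" "dist y z < d" for \<beta> y z
    proof (rule le_less_trans)
      show "\<bar>ln (u \<beta> y) / \<beta> - ln (u \<beta> z) / \<beta>\<bar> \<le> L * dist y z powr \<alpha>"
        unfolding L_def using that by (intro log_eigenfunction_local) auto
      show "L * dist y z powr \<alpha> < e / 3" using that by (intro d(2)) auto
    qed
    obtain dA where dA: "dA > 0" "\<And>y. dist y x < dA \<Longrightarrow> dist (A y) (A x) < e / 3"
      using A_cont e unfolding continuous_on_iff by (metis UNIV_I zero_less_divide_iff zero_less_numeral)
    obtain dT where dT: "dT > 0" "\<And>y. dist y x < dT \<Longrightarrow> dist (T y) (T x) < min xi d"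
      using cont xi d(1) unfolding continuous_on_iff by (metis UNIV_I min_less_iff_conj)
    show "\<exists>d>0. \<forall>f\<in>(\<lambda>\<beta> x. G \<beta> x / \<beta>) ` {1<..}. \<forall>y. dist x y < d \<longrightarrow> \<bar>f x - f y\<bar> < e"
    proof (intro exI[of _ "min (min xi d) (min dA dT)"] conjI ballI allI impI)
      show "0 < min (min xi d) (min dA dT)" using xi d(1) dA(1) dT(1) by simp
      fix f y
      assume "f \<in> (\<lambda>\<beta> x. G \<beta> x / \<beta>) ` {1<..}"
      then obtain \<beta> where b: "\<beta> > 1" and f: "f = (\<lambda>x. G \<beta> x / \<beta>)" by auto
      assume xy: "dist x y < min (min xi d) (min dA dT)"
      have "\<bar>ln (u \<beta> x) / \<beta> - ln (u \<beta> y) / \<beta>\<bar> < e / 3" using near[OF b] xy by simp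
      moreover have "\<bar>ln (u \<beta> (T x)) / \<beta> - ln (u \<beta> (T y)) / \<beta>\<bar> < e / 3"
        using near[OF b] dT(2)[of y] xy by (simp add: dist_commute)
      moreover have "\<bar>A x - A y\<bar> < e / 3"
        using dA(2)[of y] xy by (simp add: dist_commute dist_real_def abs_minus_commute)
      moreover have "f z = A z + ln (u \<beta> z) / \<beta> - ln (u \<beta> (T z)) / \<beta> - pressure T (\<lambda>x. \<beta> * A x) / \<beta>" for z
        unfolding f using b by (intro scaled_potential) simp
      ultimately show "\<bar>f x - f y\<bar> < e" by (simp only:)
    qed
  qed
qed

lemma mu_prob: "\<beta> > 0 \<Longrightarrow> borel_prob (equilibrium_state (m \<beta>) (u \<beta>))"
  by (rule ruelle_eigendata.mu_prob[OF eigendata])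

text \<open>The functionals vanish at 0 and are 1-Lipschitz, so they are bounded at each
  \<open>f\<close> by the norm of \<open>f\<close>.\<close>
lemma normal_family_log_laplace: "normal_family (\<Lambda> ` {1<..})"
proof -
  obtain D :: "('a \<Rightarrow>\<^sub>C real) set" where D: "countable D" "closure D = UNIV"
    using bcontfun_countable_dense[OF compact_space] by blast
  have lip: "\<bar>\<Lambda> \<beta> f - \<Lambda> \<beta> h\<bar> \<le> dist f h" if "\<beta> > 1" for \<beta> f h
    using that by (intro log_laplace_Lipschitz compact_space mu_prob) auto
  show ?thesis
  proof (rule normal_family_if_equicontinuous[OF D])
    fix f
    have "\<bar>\<Lambda> \<beta> f\<bar> \<le> dist f 0" if "\<beta> > 1" for \<beta>
      using lip[OF that, of f 0] log_laplace_zero[OF mu_prob, of \<beta> \<beta>] that by simp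
    then show "\<exists>M. \<forall>l\<in>\<Lambda> ` {1<..}. \<bar>l f\<bar> \<le> M" by auto
  next
    fix f and e :: real assume "e > 0"
    then show "\<exists>d>0. \<forall>l\<in>\<Lambda> ` {1<..}. \<forall>h. dist f h < d \<longrightarrow> \<bar>l f - l h\<bar> < e"
      using lip by (intro exI[of _ e]) (auto intro: le_less_trans)
  qed
qed

text \<open>Both errors in \<open>log_laplace_transfer\<close> vanish in the limit.\<close>
lemma limit_functional_invariant:
  fixes f F :: "'a \<Rightarrow>\<^sub>C real"
  assumes \<beta>: "\<And>k. \<beta> k > 0" "filterlim \<beta> at_top sequentially"
    and G: "uniform_limit UNIV (\<lambda>k x. G (\<beta> k) x / \<beta> k) B sequentially"
    and l: "\<And>f. (\<lambda>k. \<Lambda> (\<beta> k) f) \<longlonglongrightarrow> l f"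
    and F: "\<And>x. F x = Max ((\<lambda>y. f y + B y) ` (T -` {x}))"
  shows "l f = l F"
proof -
  have lim: "(\<lambda>k. \<bar>\<Lambda> (\<beta> k) f - \<Lambda> (\<beta> k) F\<bar>) \<longlonglongrightarrow> \<bar>l f - l F\<bar>"
    by (intro tendsto_intros l)
  have "\<bar>l f - l F\<bar> \<le> 0 + e" if e: "e > 0" for e
  proof (rule tendsto_upperbound[OF lim])
    have "(\<lambda>k. ln (real N) / \<beta> k) \<longlonglongrightarrow> 0"
      by (intro real_tendsto_divide_at_top[OF tendsto_const \<beta>(2)])
    then have "\<forall>\<^sub>F k in sequentially. ln (real N) / \<beta> k < e / 2"
      using e by (intro order_tendstoD(2)) auto
    moreover have "\<forall>\<^sub>F k in sequentially. \<forall>x\<in>UNIV. dist (G (\<beta> k) x / \<beta> k) (B x) < e / 2"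
      using uniform_limitD[OF G, of "e / 2"] e by simp
    ultimately show "\<forall>\<^sub>F k in sequentially. \<bar>\<Lambda> (\<beta> k) f - \<Lambda> (\<beta> k) F\<bar> \<le> 0 + e"
    proof eventually_elim
      case (elim k)
      have "\<bar>\<Lambda> (\<beta> k) f - \<Lambda> (\<beta> k) F\<bar> \<le> e / 2 + ln (real N) / \<beta> k"
        using elim(2)
        by (intro ruelle_eigendata.log_laplace_transfer[OF eigendata[OF \<beta>(1)] \<beta>(1) _ F])
          (simp add: dist_real_def less_imp_le)
      then show ?case using elim(1) by linarith
    qed
  qed simp
  then have "\<bar>l f - l F\<bar> \<le> 0" by (rule field_le_epsilon)
  then show ?thesis by simp
qed

lemma uniform_limit_potentials:
  assumes \<beta>: "\<And>k. \<beta> k > 0" "filterlim \<beta> at_top sequentially"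
    and v: "uniform_limit UNIV (\<lambda>k x. ln (u (\<beta> k) x) / \<beta> k) v sequentially"
  shows "uniform_limit UNIV (\<lambda>k x. G (\<beta> k) x / \<beta> k) (\<lambda>x. (A x - Q) + v x - v (T x)) sequentially"
proof (rule uniform_limitI)
  fix e :: real assume e: "e > 0"
  have "(\<lambda>k. real N / \<beta> k) \<longlonglongrightarrow> 0"
    by (intro real_tendsto_divide_at_top[OF tendsto_const \<beta>(2)])
  then have "\<forall>\<^sub>F k in sequentially. real N / \<beta> k < e / 3"
    using e by (intro order_tendstoD(2)) auto
  moreover have "\<forall>\<^sub>F k in sequentially. \<forall>x\<in>UNIV. dist (ln (u (\<beta> k) x) / \<beta> k) (v x) < e / 3"
    using uniform_limitD[OF v, of "e / 3"] e by simp
  ultimately show "\<forall>\<^sub>F k in sequentially. \<forall>x\<in>UNIV. dist (G (\<beta> k) x / \<beta> k) (A x - Q + v x - v (T x)) < e"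
  proof eventually_elim
    case (elim k)
    show ?case
    proof
      fix x
      have "\<bar>ln (u (\<beta> k) x) / \<beta> k - v x\<bar> < e / 3" "\<bar>ln (u (\<beta> k) (T x)) / \<beta> k - v (T x)\<bar> < e / 3"
        using elim(2) by (auto simp: dist_real_def)
      then show "dist (G (\<beta> k) x / \<beta> k) (A x - Q + v x - v (T x)) < e"
        unfolding scaled_potential[OF \<beta>(1)] dist_real_def
        using elim(1) pressure_average[OF \<beta>(1), of k] by linarith
    qed
  qed
qed

end

section \<open>The tropical adjoint operator\<close>

context expanding_system
begin

text \<open>A sum of extended reals is below \<open>c\<close> iff some real number separates
  \<open>b (T x)\<close> from \<open>c - B x\<close>; this writes the sublevel set as a union of
  open sets.\<close>
lemma upper_semicontinuous_bousch_adjoint: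
  assumes b: "upper_semicontinuous b" "\<And>x. b x \<noteq> \<infinity>" and B: "continuous_on UNIV B"
  shows "upper_semicontinuous (bousch_adjoint T B b)"
  unfolding upper_semicontinuous_def
proof
  fix c :: ereal
  have eq: "{x. bousch_adjoint T B b x < c} =
      (\<Union>r::real. T -` {y. b y < ereal r} \<inter> {x. ereal (r + B x) < c})"
  proof (intro set_eqI iffI)
    fix x assume "x \<in> {x. bousch_adjoint T B b x < c}"
    then have "b (T x) + ereal (B x) < c" by (simp add: bousch_adjoint_def)
    then have "b (T x) < c - ereal (B x)"
      using b(2)[of "T x"] by (cases c; cases "b (T x)") auto
    then obtain q where q: "b (T x) < ereal (real_of_rat q)" "ereal (real_of_rat q) < c - ereal (B x)"
      using ereal_dense3 by blast
    then have "ereal (real_of_rat q + B x) < c" by (cases c) auto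
    with q(1) show "x \<in> (\<Union>r::real. T -` {y. b y < ereal r} \<inter> {x. ereal (r + B x) < c})" by blast
  next
    fix x assume "x \<in> (\<Union>r::real. T -` {y. b y < ereal r} \<inter> {x. ereal (r + B x) < c})"
    then obtain r where "b (T x) < ereal r" "ereal (r + B x) < c" by auto
    then show "x \<in> {x. bousch_adjoint T B b x < c}"
      unfolding bousch_adjoint_def by (cases c; cases "b (T x)") auto
  qed
  have "open (T -` {y. b y < ereal r})" for r
    using b(1) cont open_vimage unfolding upper_semicontinuous_def by blast
  moreover have "open {x. ereal (r + B x) < c}" for r
    by (intro open_Collect_less continuous_intros continuous_on_ereal B)
  ultimately show "open {x. bousch_adjoint T B b x < c}"
    unfolding eq by (intro open_UN ballI open_Int)
qed

text \<open>Exchanging the supremum over \<open>x\<close> with the maximum over its fibre turns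
  \<open>l F\<close> into the supremum of \<open>f + (b \<circ> T + B)\<close>. So \<open>b \<circ>
  T + B\<close> is a density of \<open>l\<close> as well.\<close>
lemma bousch_adjoint_fixed_if_invariant:
  fixes l :: "('a \<Rightarrow>\<^sub>C real) \<Rightarrow> real"
  assumes B: "continuous_on UNIV B" and dens: "tropical_density l b"
    and inv: "\<And>f F. (\<And>x. apply_bcontfun F x = Max ((\<lambda>y. apply_bcontfun f y + B y) ` (T -` {x}))) \<Longrightarrow> l f = l F"
  shows "bousch_adjoint T B b = b"
proof -
  have l: "ereal (l f) = (SUP x. ereal (apply_bcontfun f x) + b x)" for f
    using dens by (simp add: tropical_density_def)
  have "ereal (apply_bcontfun 0 x) + b x \<le> ereal (l 0)" for x
    unfolding l by (rule SUP_upper) auto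
  then have fin: "b x \<noteq> \<infinity>" for x
    by (metis PInfty_neq_ereal(1) ereal_infty_less_eq(1) zero_bcontfun.rep_eq add.left_neutral
        zero_ereal_def)
  then have "upper_semicontinuous b" using dens by (auto simp: tropical_density_def D_max_def)
  then have "upper_semicontinuous (bousch_adjoint T B b)"
    using fin B by (rule upper_semicontinuous_bousch_adjoint)
  moreover have "bousch_adjoint T B b x \<noteq> \<infinity>" for x
    using fin[of "T x"] by (simp add: bousch_adjoint_def)
  moreover have "ereal (l f) = (SUP x. ereal (apply_bcontfun f x) + bousch_adjoint T B b x)" for f
  proof -
    define F where "F = Bcontfun (\<lambda>x. Max ((\<lambda>y. f y + B y) ` (T -` {x})))"
    have F: "F x = Max ((\<lambda>y. f y + B y) ` (T -` {x}))" for x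
      unfolding F_def
      by (subst apply_Bcontfun_compact[OF compact_space])
        (auto intro!: continuous_on_fibre_Max continuous_intros B)
    have "(SUP x. ereal (F x) + b x) = (SUP x. ereal (f x) + bousch_adjoint T B b x)"
    proof (rule antisym; rule SUP_least)
      fix x
      have "F x \<in> (\<lambda>y. f y + B y) ` (T -` {x})"
        unfolding F using finite_fibre fibre_nonempty by (intro Max_in) auto
      then obtain y where "T y = x" "F x = f y + B y" by auto
      then have "ereal (F x) + b x = ereal (f y) + bousch_adjoint T B b y"
        unfolding bousch_adjoint_def by (cases "b (T y)") auto
      also have "\<dots> \<le> (SUP x. ereal (f x) + bousch_adjoint T B b x)"
        by (rule SUP_upper) simp
      finally show "ereal (F x) + b x \<le> (SUP x. ereal (f x) + bousch_adjoint T B b x)" .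
    next
      fix y
      have "f y + B y \<le> F (T y)"
        unfolding F using finite_fibre by (intro Max_ge) auto
      then have "ereal (f y) + bousch_adjoint T B b y \<le> ereal (F (T y)) + b (T y)"
        unfolding bousch_adjoint_def by (cases "b (T y)") auto
      also have "\<dots> \<le> (SUP x. ereal (F x) + b x)" by (rule SUP_upper) auto
      finally show "ereal (f y) + bousch_adjoint T B b y \<le> (SUP x. ereal (F x) + b x)" .
    qed
    then show ?thesis using inv[OF F] l[of F] by simp
  qed
  ultimately have "tropical_density l (bousch_adjoint T B b)"
    by (auto simp: tropical_density_def D_max_def)
  then show ?thesis
    using tropical_density_unique[OF compact_space] dens by metis
qed

end

section \<open>The zero temperature limit\<close>

theorem theorem6:
  fixes T :: "'a::metric_space \<Rightarrow> 'a" and A :: "'a \<Rightarrow> real" and \<alpha> :: real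
    and m :: "real \<Rightarrow> 'a measure" and u :: "real \<Rightarrow> 'a \<Rightarrow> real"
    and g :: "real \<Rightarrow> 'a \<Rightarrow> real" and l :: "real \<Rightarrow> ('a \<Rightarrow>\<^sub>C real) \<Rightarrow> real"
  assumes X: "compact (UNIV :: 'a set)"
    and T: "expanding_covering_map T" "topologically_transitive T"
    and A: "0 < \<alpha>" "\<alpha> \<le> 1" "holder_continuous \<alpha> A"
    and m: "\<And>\<beta>. \<beta> > 0 \<Longrightarrow> eigenmeasure T (\<lambda>x. \<beta> * A x) (m \<beta>)"
    and u: "\<And>\<beta>. \<beta> > 0 \<Longrightarrow> eigenfunction T (\<lambda>x. \<beta> * A x) (m \<beta>) (u \<beta>)"
    and g: "\<And>\<beta>. \<beta> > 0 \<Longrightarrow> g \<beta> = normalized_potential T (\<lambda>x. \<beta> * A x) (u \<beta>)"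
    and l: "\<And>\<beta>. \<beta> > 0 \<Longrightarrow> l \<beta> = log_laplace \<beta> (equilibrium_state (m \<beta>) (u \<beta>))"
  shows "(normal_family ((\<lambda>\<beta> x. g \<beta> x / \<beta>) ` {1<..}) \<and> normal_family (l ` {1<..}))
    \<and> (\<forall>\<beta> Ahat lhat.
         (\<forall>k. \<beta> k > 0) \<and> filterlim \<beta> at_top sequentially \<and> continuous_on UNIV Ahat \<and>
         uniform_limit UNIV (\<lambda>k x. g (\<beta> k) x / \<beta> k) Ahat sequentially \<and>
         (\<forall>f. (\<lambda>k. l (\<beta> k) f) \<longlonglongrightarrow> lhat f)
       \<longrightarrow> tropical_linear lhat \<and>
           (\<exists>!b. tropical_density lhat b) \<and>
           (\<forall>b. tropical_density lhat b \<longrightarrow> bousch_adjoint T Ahat b = b))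
    \<and> (\<forall>\<beta> v.
         (\<forall>k. \<beta> k > 0) \<and> filterlim \<beta> at_top sequentially \<and> continuous_on UNIV v \<and>
         uniform_limit UNIV (\<lambda>k x. ln (u (\<beta> k) x) / \<beta> k) v sequentially
       \<longrightarrow> uniform_limit UNIV (\<lambda>k x. g (\<beta> k) x / \<beta> k)
             (\<lambda>x. (A x - max_ergodic_average T A) + v x - v (T x)) sequentially)"
proof -
  obtain lam eta xi where "expanding_system T lam eta xi"
    using expanding_covering_map_system[OF X T] by blast
  then interpret expanding_system T lam eta xi .
  obtain C where C: "\<And>x y. \<bar>A x - A y\<bar> \<le> C * dist x y powr \<alpha>"
    using A(3) unfolding holder_continuous_def by blast
  have C': "\<bar>A x - A y\<bar> \<le> max C 0 * dist x y powr \<alpha>" for x y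
    using C[of x y] mult_right_mono[of C "max C 0" "dist x y powr \<alpha>"] by simp
  obtain N where N: "\<And>x. card (T -` {x}) \<le> N"
    using fibre_card_bound by blast
  interpret F: ruelle_family T lam eta xi A \<alpha> "max C 0" u m N
    by unfold_locales (use C' A(1) m u N in auto)
  have "(\<lambda>\<beta> x. g \<beta> x / \<beta>) ` {1<..} = (\<lambda>\<beta> x. F.G \<beta> x / \<beta>) ` {1<..}"
    by (intro image_cong refl ext) (simp add: g)
  moreover have "l ` {1<..} = F.\<Lambda> ` {1<..}"
    by (intro image_cong refl) (simp add: l)
  ultimately have normal: "normal_family ((\<lambda>\<beta> x. g \<beta> x / \<beta>) ` {1<..})" "normal_family (l ` {1<..})"
    using F.normal_family_potentials F.normal_family_log_laplace by simp_all
  have limit: "tropical_linear lhat \<and> (\<exists>!b. tropical_density lhat b) \<and>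
      (\<forall>b. tropical_density lhat b \<longrightarrow> bousch_adjoint T Ahat b = b)"
    if \<beta>: "\<And>k. \<beta> k > 0" "filterlim \<beta> at_top sequentially" and Ahat: "continuous_on UNIV Ahat"
      and conv: "uniform_limit UNIV (\<lambda>k x. g (\<beta> k) x / \<beta> k) Ahat sequentially"
      and lconv: "\<And>f. (\<lambda>k. l (\<beta> k) f) \<longlonglongrightarrow> lhat f"
    for \<beta> :: "nat \<Rightarrow> real" and Ahat lhat
  proof -
    have conv': "uniform_limit UNIV (\<lambda>k x. F.G (\<beta> k) x / \<beta> k) Ahat sequentially"
      using conv by (simp add: g[OF \<beta>(1)])
    have lconv': "\<And>f. (\<lambda>k. F.\<Lambda> (\<beta> k) f) \<longlonglongrightarrow> lhat f"
      using lconv by (simp add: l[OF \<beta>(1)])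
    have lin: "tropical_linear lhat"
      by (rule tropical_linear_limit[OF X F.mu_prob[OF \<beta>(1)] \<beta> lconv'])
    have "\<exists>!b. tropical_density lhat b"
      using tropical_density_maximal_density[OF X lin] tropical_density_unique[OF X] by metis
    moreover have "bousch_adjoint T Ahat b = b" if "tropical_density lhat b" for b
      by (rule bousch_adjoint_fixed_if_invariant[OF Ahat that])
        (rule F.limit_functional_invariant[OF \<beta> conv' lconv'])
    ultimately show ?thesis using lin by blast
  qed
  have subaction: "uniform_limit UNIV (\<lambda>k x. g (\<beta> k) x / \<beta> k)
      (\<lambda>x. (A x - max_ergodic_average T A) + v x - v (T x)) sequentially"
    if \<beta>: "\<And>k. \<beta> k > 0" "filterlim \<beta> at_top sequentially"
      and v: "uniform_limit UNIV (\<lambda>k x. ln (u (\<beta> k) x) / \<beta> k) v sequentially"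
    for \<beta> :: "nat \<Rightarrow> real" and v
    using F.uniform_limit_potentials[OF \<beta> v] by (simp add: g[OF \<beta>(1)])
  show ?thesis
  proof (intro conjI normal; intro allI impI; elim conjE)
    fix \<beta> Ahat lhat
    assume "\<forall>k. \<beta> k > 0" "filterlim \<beta> at_top sequentially" "continuous_on UNIV Ahat"
      "uniform_limit UNIV (\<lambda>k x. g (\<beta> k) x / \<beta> k) Ahat sequentially"
      "\<forall>f. (\<lambda>k. l (\<beta> k) f) \<longlonglongrightarrow> lhat f"
    then show "tropical_linear lhat \<and> (\<exists>!b. tropical_density lhat b) \<and>
        (\<forall>b. tropical_density lhat b \<longrightarrow> bousch_adjoint T Ahat b = b)"
      by (intro limit[of \<beta>]) simp_all
  next
    fix \<beta> v
    assume "\<forall>k. \<beta> k > 0" "filterlim \<beta> at_top sequentially"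
      "uniform_limit UNIV (\<lambda>k x. ln (u (\<beta> k) x) / \<beta> k) v sequentially"
    then show "uniform_limit UNIV (\<lambda>k x. g (\<beta> k) x / \<beta> k)
        (\<lambda>x. (A x - max_ergodic_average T A) + v x - v (T x)) sequentially"
      by (intro subaction) simp_all
  qed
qed

end
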